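(* Let $G$ be a $2$-connected subcubic outerplanar graph, let $v$ be a vertex of $G$, and let $c\in\{\text{red},\text{blue}\}$. Then $G$ admits a crumby coloring in which $v$ receives color $c$.
   Context: A graph is subcubic if it has maximum degree at most $3$. A crumby coloring of a graph $H$ is a coloring of the vertices of $H$ with two colors, red and blue, such that the subgraph induced by the blue vertices has maximum degree at most $1$, and the subgraph induced by the red vertices has minimum degree at least $1$ and contains no path with $3$ edges. *)

theory Defs
  imports "HOL-Analysis.Analysis"
begin

record 'a ugraph =
  vertices :: "'a set"
  edges :: "'a set set"

definition simple_graph :: "'a ugraph \<Rightarrow> bool" where
  "simple_graph G \<longleftrightarrow>
     finite (vertices G) \<and> (\<forall>e\<in>edges G. e \<subseteq> vertices G \<and> card e = 2)"

definition vertex_degree :: "'a ugraph \<Rightarrow> 'a \<Rightarrow> nat" where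
  "vertex_degree G v = card {e \<in> edges G. v \<in> e}"

definition subcubic :: "'a ugraph \<Rightarrow> bool" where
  "subcubic G \<longleftrightarrow> (\<forall>v\<in>vertices G. vertex_degree G v \<le> 3)"

definition induced_subgraph :: "'a ugraph \<Rightarrow> 'a set \<Rightarrow> 'a ugraph" where
  "induced_subgraph G U = \<lparr>vertices = vertices G \<inter> U, edges = {e \<in> edges G. e \<subseteq> U}\<rparr>"

text \<open>A path is the list of its pairwise distinct vertices; it has \<open>length p - 1\<close> edges.\<close>

definition graph_path :: "'a ugraph \<Rightarrow> 'a list \<Rightarrow> bool" where
  "graph_path G p \<longleftrightarrow>
     p \<noteq> [] \<and> distinct p \<and> set p \<subseteq> vertices G \<and>
     (\<forall>i. Suc i < length p \<longrightarrow> {p ! i, p ! Suc i} \<in> edges G)"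

definition graph_connected :: "'a ugraph \<Rightarrow> bool" where
  "graph_connected G \<longleftrightarrow>
     vertices G \<noteq> {} \<and>
     (\<forall>u\<in>vertices G. \<forall>w\<in>vertices G. \<exists>p. graph_path G p \<and> hd p = u \<and> last p = w)"

definition k_connected :: "nat \<Rightarrow> 'a ugraph \<Rightarrow> bool" where
  "k_connected k G \<longleftrightarrow>
     card (vertices G) > k \<and>
     (\<forall>X. X \<subseteq> vertices G \<and> card X < k \<longrightarrow>
        graph_connected (induced_subgraph G (vertices G - X)))"

text \<open>
  A drawing in the plane (identified with the complex numbers) represents each edge by an arc
  joining its two ends; an arc contains no further vertices, and two arcs meet only in common
  ends.
\<close>

definition plane_drawing ::
    "'a ugraph \<Rightarrow> ('a \<Rightarrow> complex) \<Rightarrow> ('a set \<Rightarrow> real \<Rightarrow> complex) \<Rightarrow> bool" where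
  "plane_drawing G pos \<gamma> \<longleftrightarrow>
     inj_on pos (vertices G) \<and>
     (\<forall>e\<in>edges G. arc (\<gamma> e) \<and>
        {pathstart (\<gamma> e), pathfinish (\<gamma> e)} = pos ` e \<and>
        path_image (\<gamma> e) \<inter> pos ` vertices G = pos ` e) \<and>
     (\<forall>e\<in>edges G. \<forall>e'\<in>edges G. e \<noteq> e' \<longrightarrow>
        path_image (\<gamma> e) \<inter> path_image (\<gamma> e') = pos ` (e \<inter> e'))"

definition drawing_image ::
    "'a ugraph \<Rightarrow> ('a \<Rightarrow> complex) \<Rightarrow> ('a set \<Rightarrow> real \<Rightarrow> complex) \<Rightarrow> complex set" where
  "drawing_image G pos \<gamma> = pos ` vertices G \<union> (\<Union>e\<in>edges G. path_image (\<gamma> e))"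

text \<open>
  For a finite graph the drawing is compact, so \<open>outside\<close> of its image, the union of the
  unbounded components of the complement, is the single outer face.
\<close>

definition outerplanar :: "'a ugraph \<Rightarrow> bool" where
  "outerplanar G \<longleftrightarrow>
     (\<exists>pos \<gamma>. plane_drawing G pos \<gamma> \<and>
        (\<forall>v\<in>vertices G. pos v \<in> frontier (outside (drawing_image G pos \<gamma>))))"

datatype color = Red | Blue

definition color_subgraph :: "'a ugraph \<Rightarrow> ('a \<Rightarrow> color) \<Rightarrow> color \<Rightarrow> 'a ugraph" where
  "color_subgraph G f c = induced_subgraph G {v \<in> vertices G. f v = c}"

text \<open>
  Either color class may be empty; the degree conditions are then vacuous. The red paths
  with 3 edges need not be induced.
\<close>

definition crumby_coloring :: "'a ugraph \<Rightarrow> ('a \<Rightarrow> color) \<Rightarrow> bool" where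
  "crumby_coloring G f \<longleftrightarrow>
     (\<forall>v\<in>vertices (color_subgraph G f Blue). vertex_degree (color_subgraph G f Blue) v \<le> 1) \<and>
     (\<forall>v\<in>vertices (color_subgraph G f Red). vertex_degree (color_subgraph G f Red) v \<ge> 1) \<and>
     \<not> (\<exists>p. graph_path (color_subgraph G f Red) p \<and> length p - 1 = 3)"

end

theory Submission
  imports Defs
begin

text \<open>
  A longest cycle of \<open>G\<close> is Hamiltonian: an ear attached to it would either lengthen it or close
  three internally disjoint paths with inner vertices between the same ends, and in a drawing of
  such a theta graph one of the three paths lies inside the cycle formed by the other two, hence
  off the outer face. The same argument places all chords inside the Hamiltonian cycle, where they
  cannot cross. So \<open>G\<close> is a cycle with a non-crossing matching of chords.

  Red components are sought among stars with at least one edge, which makes the coloring condition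
  local: every vertex is blue, a centre or a leaf, and only the labels of its neighbours matter.
  A segment of the cycle closed under the matching acts on its surroundings through a relation
  between the label pairs at its two borders. Building up segments by single vertices and chords,
  one finds that every relation which arises contains one of 17 relations, and all of these except
  those of the segments with one and two vertices can be closed to a cycle with either color at a
  given position.
\<close>

subsection \<open>Labellings of chorded cycles\<close>

text \<open>
  Blue vertices, leaves and centres of red stars. In a red star with a single edge either end may
  serve as the centre.
\<close>

datatype label = Bl | Lf | Ct

text \<open>The neighbour labels form a list because the blue and the leaf condition count
  neighbours. The leaf and centre clauses together force every red component to be a star with at
  least one edge.\<close>

fun admissible :: "label \<Rightarrow> label list \<Rightarrow> bool" where
  "admissible Bl ns \<longleftrightarrow> length (filter (\<lambda>l. l = Bl) ns) \<le> 1"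
| "admissible Lf ns \<longleftrightarrow> filter (\<lambda>l. l \<noteq> Bl) ns = [Ct]"
| "admissible Ct ns \<longleftrightarrow> Lf \<in> set ns \<and> Ct \<notin> set ns"

text \<open>
  An entry \<open>((x, a), (b, y))\<close> of the transfer relation of a segment says that the first and last
  vertex of the segment can be labelled \<open>a\<close> and \<open>b\<close> when the vertices just before and after it are
  labelled \<open>x\<close> and \<open>y\<close>. With this format, concatenation of segments is relation composition.
\<close>

type_synonym transfer = "((label \<times> label) \<times> (label \<times> label)) list"

definition labels :: "label list" where
  "labels = [Bl, Lf, Ct]"

definition single :: transfer where
  "single = [((x, a), (a, y)). x \<leftarrow> labels, a \<leftarrow> labels, y \<leftarrow> labels, admissible a [x, y]]"

definition seq :: "transfer \<Rightarrow> transfer \<Rightarrow> transfer" where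
  "seq A B = remdups [(p, s). (p, q) \<leftarrow> A, (r, s) \<leftarrow> B, q = r]"

text \<open>The vertices just before and after the segment of \<open>A\<close> become the ends of
  the chord. Their labels \<open>p\<close> and \<open>q\<close>, so far border labels without a
  condition of their own, are now checked, each with the other as third neighbour.\<close>

definition chord :: "transfer \<Rightarrow> transfer" where
  "chord A = remdups [((x, p), (q, y)). ((p, p'), (q', q)) \<leftarrow> A, x \<leftarrow> labels, admissible p [x, p', q],
     y \<leftarrow> labels, admissible q [q', y, p]]"

section \<open>Ears and the finite list of profiles\<close>

definition ear1 :: transfer where "ear1 = chord single"
definition ear2 :: transfer where "ear2 = chord (seq single single)"
definition ear3 :: transfer where "ear3 = chord (seq single (seq single single))"

text \<open>
  The minimal transfer relations of segments with at least three vertices; shorter segments are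
  kept apart in \<open>profiles\<close> because they do not close up to a cycle.
\<close>

definition long_profiles :: "transfer list" where
  "long_profiles = (let v2 = seq single single; v3 = seq single v2 in
     [v3, seq single v3,
      ear1, seq single ear1, seq ear1 single, seq ear1 v2, seq v2 ear1, seq single (seq ear1 single),
      ear2, seq single ear2, seq ear2 single, seq ear2 v2, seq v2 ear2, seq single (seq ear2 single),
      ear3])"

definition profiles :: "transfer list" where
  "profiles = single # seq single single # long_profiles"

text \<open>A relation with fewer entries promises less, so a segment realizing \<open>A\<close>
  realizes every relation contained in \<open>A\<close>. It therefore suffices to keep track of
  small relations.\<close>

definition covered :: "transfer list \<Rightarrow> transfer \<Rightarrow> bool" where
  "covered Ps A \<longleftrightarrow> (\<exists>P\<in>set Ps. set P \<subseteq> set A)"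

text \<open>This keeps the list of profiles finite under nesting: whatever lies below a chord, the
  chord can be treated as one above at most three chordless vertices.\<close>

lemma chord_profiles: "\<forall>P\<in>set profiles. covered [ear1, ear2, ear3] (chord P)"
  by code_simp

text \<open>The profile \<open>single\<close> is left out because a vertex put before it gives a
  segment with only two vertices, which is handled separately.\<close>

lemma single_profiles: "\<forall>P\<in>set (tl profiles). covered long_profiles (seq single P)"
  by code_simp

lemma ear1_profiles: "\<forall>P\<in>set profiles. covered long_profiles (seq ear1 P)"
  by code_simp

lemma ear2_profiles: "\<forall>P\<in>set profiles. covered long_profiles (seq ear2 P)"
  by code_simp

lemma ear3_profiles: "\<forall>P\<in>set profiles. covered long_profiles (seq ear3 P)"
  by code_simp

text \<open>When a segment is closed to a cycle, its last vertex precedes its first one, so the two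
  border pairs must coincide. The two entries provide both colors for the first vertex.\<close>

lemma closing_profiles:
  "\<forall>P\<in>set long_profiles.
     (\<exists>x\<in>set labels. ((x, Bl), (x, Bl)) \<in> set P) \<and>
     (\<exists>x\<in>set labels. \<exists>a\<in>set labels. a \<noteq> Bl \<and> ((x, a), (x, a)) \<in> set P)"
  by code_simp

text \<open>
  The vertices of a cycle are numbered consecutively and \<open>m\<close> exchanges the two ends of each chord,
  fixing the vertices without chord.
\<close>

definition labelled :: "(nat \<Rightarrow> nat) \<Rightarrow> (nat \<Rightarrow> label) \<Rightarrow> nat \<Rightarrow> nat \<Rightarrow> bool" where
  "labelled m g i j \<longleftrightarrow> (\<forall>k\<in>{i..<j}.
     admissible (g k) ([g (k - 1), g (k + 1)] @ (if m k = k then [] else [g (m k)])))"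

text \<open>Only positions of the segment itself must be admissible; \<open>i - 1\<close> and
  \<open>j\<close> merely carry border labels. The constructions below assume
  \<open>1 \<le> i\<close>, which makes \<open>i - 1\<close> a position of its own despite truncated
  subtraction.\<close>

definition realizes :: "(nat \<Rightarrow> nat) \<Rightarrow> nat \<Rightarrow> nat \<Rightarrow> transfer \<Rightarrow> bool" where
  "realizes m i j A \<longleftrightarrow> (\<forall>x a b y. ((x, a), (b, y)) \<in> set A \<longrightarrow>
     (\<exists>g. labelled m g i j \<and> g (i - 1) = x \<and> g i = a \<and> g (j - 1) = b \<and> g j = y))"

definition mate_closed :: "(nat \<Rightarrow> nat) \<Rightarrow> nat \<Rightarrow> nat \<Rightarrow> bool" where
  "mate_closed m i j \<longleftrightarrow> (\<forall>k\<in>{i..<j}. m k \<in> {i..<j})"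

section \<open>Realizing transfer relations by labellings of segments\<close>

lemma realizes_mono: "realizes m i j A \<Longrightarrow> set B \<subseteq> set A \<Longrightarrow> realizes m i j B"
  unfolding realizes_def by blast

lemma realizes_single:
  assumes "m i = i" "1 \<le> i"
  shows "realizes m i (i + 1) single"
  unfolding realizes_def
proof (intro allI impI)
  fix x a b y assume "((x, a), (b, y)) \<in> set single"
  then have ab: "b = a" "admissible a [x, y]" by (auto simp: single_def)
  let ?g = "(\<lambda>_. x)(i := a, i + 1 := y)"
  have "labelled m ?g i (i + 1)"
    using ab assms by (auto simp: labelled_def)
  then show "\<exists>g. labelled m g i (i + 1) \<and> g (i - 1) = x \<and> g i = a \<and> g (i + 1 - 1) = b \<and> g (i + 1) = y"
    using ab assms by (intro exI[of _ ?g]) auto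
qed

lemma realizes_seq:
  assumes A: "realizes m i j A" and B: "realizes m j k B"
    and ij: "mate_closed m i j" and jk: "mate_closed m j k"
    and le: "1 \<le> i" "i < j" "j < k"
  shows "realizes m i k (seq A B)"
  unfolding realizes_def
proof (intro allI impI)
  fix x a b y assume "((x, a), (b, y)) \<in> set (seq A B)"
  then obtain c d where cd: "((x, a), (c, d)) \<in> set A" "((c, d), (b, y)) \<in> set B"
    by (auto simp: seq_def)
  obtain g where g: "labelled m g i j" "g (i - 1) = x" "g i = a" "g (j - 1) = c" "g j = d"
    using A cd(1) unfolding realizes_def by blast
  obtain h where h: "labelled m h j k" "h (j - 1) = c" "h j = d" "h (k - 1) = b" "h k = y"
    using B cd(2) unfolding realizes_def by blast
  \<comment> \<open>Both labellings agree at \<open>j - 1\<close> and \<open>j\<close>, so next to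
    the border every position still sees the labels of its own labelling. Mates never cross the
    border because both segments are closed under \<open>m\<close>.\<close>
  let ?f = "\<lambda>l. if l < j then g l else h l"
  have "labelled m ?f i k"
    unfolding labelled_def
  proof
    fix l assume l: "l \<in> {i..<k}"
    show "admissible (?f l) ([?f (l - 1), ?f (l + 1)] @ (if m l = l then [] else [?f (m l)]))"
    proof (cases "l < j")
      case True
      then have "m l < j" using ij l by (auto simp: mate_closed_def)
      moreover have "?f (l + 1) = g (l + 1)" using True g h by (cases "l + 1 = j") auto
      moreover have "admissible (g l) ([g (l - 1), g (l + 1)] @ (if m l = l then [] else [g (m l)]))"
        using g(1) l True by (simp add: labelled_def)
      ultimately show ?thesis using True by (cases "m l = l") (auto simp: less_imp_diff_less)
    next
      case False
      then have "\<not> m l < j" using jk l by (auto simp: mate_closed_def not_less)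
      moreover have "?f (l - 1) = h (l - 1)" using False g h le by (cases "l = j") auto
      moreover have "admissible (h l) ([h (l - 1), h (l + 1)] @ (if m l = l then [] else [h (m l)]))"
        using h(1) l False by (simp add: labelled_def)
      ultimately show ?thesis using False by (cases "m l = l") auto
    qed
  qed
  moreover have "?f (i - 1) = x \<and> ?f i = a \<and> ?f (k - 1) = b \<and> ?f k = y"
    using g h le by auto
  ultimately show "\<exists>g. labelled m g i k \<and> g (i - 1) = x \<and> g i = a \<and> g (k - 1) = b \<and> g k = y"
    by blast
qed

lemma realizes_chord:
  assumes A: "realizes m (i + 1) j A" and closed: "mate_closed m (i + 1) j"
    and m: "m i = j" "m j = i" and le: "1 \<le> i" "i + 1 < j"
  shows "realizes m i (j + 1) (chord A)"
  unfolding realizes_def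
proof (intro allI impI)
  fix x a b y assume "((x, a), (b, y)) \<in> set (chord A)"
  then obtain a' b' where 1: "((a, a'), (b', b)) \<in> set A" "admissible a [x, a', b]" "admissible b [b', y, a]"
    by (auto simp: chord_def)
  obtain g where g: "labelled m g (i + 1) j" "g i = a" "g (i + 1) = a'" "g (j - 1) = b'" "g j = b"
    using A 1(1) unfolding realizes_def by fastforce
  \<comment> \<open>The labels of \<open>i\<close> and \<open>j\<close> are already given by the
    borders of the inner segment. The overwritten positions are not seen from inside it.\<close>
  let ?f = "g(i - 1 := x, j + 1 := y)"
  have "labelled m ?f i (j + 1)"
    unfolding labelled_def
  proof
    fix l assume l: "l \<in> {i..<j + 1}"
    then consider "l = i" | "l = j" | "i + 1 \<le> l" "l < j" by fastforce
    then show "admissible (?f l) ([?f (l - 1), ?f (l + 1)] @ (if m l = l then [] else [?f (m l)]))"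
    proof cases
      case 3
      then have "i + 1 \<le> m l" "m l < j"
        using closed by (auto simp: mate_closed_def)
      moreover have "admissible (g l) ([g (l - 1), g (l + 1)] @ (if m l = l then [] else [g (m l)]))"
        using g(1) 3 by (simp add: labelled_def)
      ultimately show ?thesis using 3 le by auto
    qed (use 1 g m le in auto)
  qed
  moreover have "?f (i - 1) = x \<and> ?f i = a \<and> ?f j = b \<and> ?f (j + 1) = y"
    using g le by auto
  ultimately show "\<exists>g. labelled m g i (j + 1) \<and> g (i - 1) = x \<and> g i = a \<and> g (j + 1 - 1) = b \<and> g (j + 1) = y"
    by (intro exI[of _ ?f]) simp
qed

lemma realizes_covered:
  "realizes m i j A \<Longrightarrow> covered Ps A \<Longrightarrow> \<exists>P\<in>set Ps. realizes m i j P"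
  unfolding covered_def using realizes_mono by blast

text \<open>Induction on the length, splitting at the first position: it is either a single
  chordless vertex or the left end of a chord above a shorter segment. \<open>nested\<close> and
  \<open>inv\<close> keep all pieces closed under \<open>m\<close>. The two shortest cases record
  their length so that cycles with at least three vertices can rule them out.\<close>

lemma realizes_profile:
  assumes "mate_closed m i j" "1 \<le> i" "i < j"
    and inv: "\<And>k. m (m k) = k" and gap: "\<And>k. m k \<noteq> k + 1"
    and nested: "\<And>k l. k < l \<Longrightarrow> l < m k \<Longrightarrow> k < m l \<and> m l < m k"
  shows "j = i + 1 \<and> realizes m i j single \<or> j = i + 2 \<and> realizes m i j (seq single single)
    \<or> (\<exists>P\<in>set long_profiles. realizes m i j P)"
  using assms(1-3)
proof (induction "j - i" arbitrary: i j rule: less_induct)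
  case less
  have IH: "\<exists>P\<in>set profiles. realizes m i' j' P"
    if "mate_closed m i' j'" "1 \<le> i'" "i' < j'" "j' - i' < j - i" for i' j'
    using less.hyps[OF that(4,1-3)] by (auto simp: profiles_def)
  have mi: "i \<le> m i" "m i < j" using less.prems by (auto simp: mate_closed_def)
  show ?case
  proof (cases "m i = i")
    case True
    note s = realizes_single[of m, OF True less.prems(2)]
    have c1: "mate_closed m i (i + 1)" using True by (auto simp: mate_closed_def)
    have c2: "mate_closed m (i + 1) j"
      unfolding mate_closed_def
    proof
      fix k assume k: "k \<in> {i + 1..<j}"
      then have "m k \<noteq> i" using True inv by (metis Suc_eq_plus1 atLeastLessThan_iff not_less_eq_eq order_refl)
      moreover have "m k \<in> {i..<j}" using less.prems(1) k by (simp add: mate_closed_def)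
      ultimately show "m k \<in> {i + 1..<j}" by auto
    qed
    show ?thesis
    proof (cases "j = i + 1")
      case True
      then show ?thesis using s by simp
    next
      case False
      then have lt: "i + 1 < j" using less.prems by simp
      have "j = i + 1 + 1 \<and> realizes m (i + 1) j single \<or> (\<exists>P\<in>set (tl profiles). realizes m (i + 1) j P)"
        using less.hyps[OF _ c2 _ lt] lt by (auto simp: profiles_def)
      then show ?thesis
      proof
        assume "j = i + 1 + 1 \<and> realizes m (i + 1) j single"
        then show ?thesis using realizes_seq[OF s _ c1 c2] less.prems lt by auto
      next
        assume "\<exists>P\<in>set (tl profiles). realizes m (i + 1) j P"
        then obtain P where P: "P \<in> set (tl profiles)" "realizes m (i + 1) j P" by blast
        then show ?thesis
          using realizes_covered[OF realizes_seq[OF s P(2) c1 c2]] single_profiles less.prems lt by auto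
      qed
    qed
  next
    case False
    let ?k = "m i"
    \<comment> \<open>By \<open>gap\<close> at least one vertex lies below the chord, so the
      induction hypothesis applies to a nonempty segment.\<close>
    have k: "i + 1 < ?k" using False mi gap[of i] by auto
    have c: "mate_closed m (i + 1) ?k"
      using nested[of i] by (auto simp: mate_closed_def Suc_le_eq)
    have c1: "mate_closed m i (?k + 1)"
      unfolding mate_closed_def
    proof
      fix l assume "l \<in> {i..<?k + 1}"
      then consider "l = i" | "l = ?k" | "i < l" "l < ?k" by fastforce
      then show "m l \<in> {i..<?k + 1}" using nested[of i l] inv[of i] k by cases auto
    qed
    have c2: "mate_closed m (?k + 1) j"
      unfolding mate_closed_def
    proof
      fix l assume l: "l \<in> {?k + 1..<j}"
      have "m l \<in> {i..<j}" using less.prems(1) l k by (auto simp: mate_closed_def)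
      moreover have "m l \<notin> {i..<?k + 1}"
        using c1 inv[of l] l unfolding mate_closed_def by fastforce
      ultimately show "m l \<in> {?k + 1..<j}" by auto
    qed
    have "?k - (i + 1) < j - i" using k mi by linarith
    then obtain P where P: "P \<in> set profiles" "realizes m (i + 1) ?k P"
      using IH[OF c _ k] by auto
    have "realizes m i (?k + 1) (chord P)"
      using realizes_chord[OF P(2) c] inv k less.prems by auto
    moreover have "covered [ear1, ear2, ear3] (chord P)" using chord_profiles P(1) by blast
    ultimately have "\<exists>E\<in>set [ear1, ear2, ear3]. realizes m i (?k + 1) E" by (rule realizes_covered)
    then obtain E where E: "E \<in> {ear1, ear2, ear3}" "realizes m i (?k + 1) E"
      unfolding list.set by blast
    show ?thesis
    proof (cases "j = ?k + 1")
      case True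
      then show ?thesis using E by (auto simp: long_profiles_def Let_def)
    next
      case False
      then have lt: "?k + 1 < j" using mi by simp
      have "j - (?k + 1) < j - i" using k mi by linarith
      then obtain Q where Q: "Q \<in> set profiles" "realizes m (?k + 1) j Q"
        using IH[OF c2 _ lt] by auto
      then have "realizes m i j (seq E Q)"
        using realizes_seq[OF E(2) Q(2) c1 c2] less.prems lt k by auto
      moreover have "covered long_profiles (seq E Q)"
        using E(1) Q(1) ear1_profiles ear2_profiles ear3_profiles by auto
      ultimately show ?thesis using realizes_covered by blast
    qed
  qed
qed

lemma cyclic_labelling:
  assumes "mate_closed m 1 (n + 1)" "3 \<le> n"
    and inv: "\<And>k. m (m k) = k" and gap: "\<And>k. m k \<noteq> k + 1"
    and nested: "\<And>k l. k < l \<Longrightarrow> l < m k \<Longrightarrow> k < m l \<and> m l < m k"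
  obtains g where "labelled m g 1 (n + 1)" "g 0 = g n" "g (n + 1) = g 1" "g 1 = Bl \<longleftrightarrow> blue"
proof -
  \<comment> \<open>The cycle is cut open before position 1; \<open>3 \<le> n\<close> excludes the
    two short cases.\<close>
  obtain P where P: "P \<in> set long_profiles" "realizes m 1 (n + 1) P"
    using realizes_profile[OF assms(1) _ _ inv gap nested] assms(2) by auto
  obtain x a where xa: "((x, a), (x, a)) \<in> set P" "a = Bl \<longleftrightarrow> blue"
    using closing_profiles P(1) by (cases blue) blast+
  then obtain g where "labelled m g 1 (n + 1)" "g (1 - 1) = x" "g 1 = a" "g (n + 1 - 1) = x" "g (n + 1) = a"
    using P(2) unfolding realizes_def by blast
  then show ?thesis using that xa(2) by auto
qed

subsection \<open>Theta curves\<close>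

text \<open>\<open>outside\<close> is antitone, so the open set \<open>inside S\<close> misses
  \<open>outside D\<close> and hence its closure. Outerplanarity enters here: with \<open>D\<close>
  the drawing, no vertex lies inside a closed curve of the drawing.\<close>

lemma inside_avoids_frontier_outside:
  fixes D :: "complex set"
  assumes "S \<subseteq> D" "closed S" "x \<in> frontier (outside D)"
  shows "x \<notin> inside S"
proof
  assume "x \<in> inside S"
  moreover have "open (inside S)" by (simp add: assms open_inside)
  moreover have "inside S \<inter> outside D = {}"
    using outside_mono[OF assms(1)] by (metis disjoint_iff inside_Int_outside subsetD)
  ultimately show False
    using assms(3) by (metis DiffD1 frontier_def IntI empty_iff open_Int_closure_eq_empty)
qed

definition theta :: "complex \<Rightarrow> complex \<Rightarrow> (real \<Rightarrow> complex) \<Rightarrow> (real \<Rightarrow> complex) \<Rightarrow> (real \<Rightarrow> complex) \<Rightarrow> bool" where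
  "theta a b c1 c2 c3 \<longleftrightarrow>
     (\<forall>c\<in>{c1, c2, c3}. arc c \<and> pathstart c = a \<and> pathfinish c = b) \<and>
     path_image c1 \<inter> path_image c2 = {a, b} \<and>
     path_image c1 \<inter> path_image c3 = {a, b} \<and>
     path_image c2 \<inter> path_image c3 = {a, b}"

lemma theta_rotate: "theta a b c1 c2 c3 \<Longrightarrow> theta a b c2 c3 c1"
  by (auto simp: theta_def)

lemma theta_swap: "theta a b c1 c2 c3 \<Longrightarrow> theta a b c2 c1 c3"
  by (auto simp: theta_def)

lemma theta_loop:
  assumes "theta a b c1 c2 c3"
  obtains c where "simple_path c" "pathfinish c = pathstart c"
    "path_image c = path_image c1 \<union> path_image c2"
proof
  show "simple_path (c1 +++ reversepath c2)"
    using assms by (intro simple_path_join_loop) (auto simp: theta_def arc_reversepath)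
  show "pathfinish (c1 +++ reversepath c2) = pathstart (c1 +++ reversepath c2)"
    using assms by (auto simp: theta_def)
  show "path_image (c1 +++ reversepath c2) = path_image c1 \<union> path_image c2"
    using assms by (subst path_image_join) (auto simp: theta_def)
qed

text \<open>The Jordan curve theorem for the loop of the first two arcs; rotating and swapping the
  arcs gives the other loops.\<close>

lemma theta_Jordan:
  assumes "theta a b c1 c2 c3"
  defines "S \<equiv> path_image c1 \<union> path_image c2"
  shows "inside S \<noteq> {}" "open (inside S)" "connected (inside S)" "connected (outside S)"
    "frontier (inside S) = S" "compact S" "closed S"
proof -
  obtain c where "simple_path c" "pathfinish c = pathstart c" "path_image c = S"
    using theta_loop[OF assms(1)] S_def by metis
  from Jordan_inside_outside[OF this(1,2)] this compact_simple_path_image[OF this(1)]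
  show "inside S \<noteq> {}" "open (inside S)" "connected (inside S)" "connected (outside S)"
    "frontier (inside S) = S" "compact S" "closed S" by (auto simp: compact_imp_closed)
qed

lemma theta_open_arc:
  assumes "theta a b c1 c2 c3"
  shows "connected (path_image c1 - {a, b})" "path_image c1 - {a, b} \<noteq> {}"
    "path_image c1 \<subseteq> closure (path_image c1 - {a, b})"
proof -
  have c1: "simple_path c1" "pathstart c1 = a" "pathfinish c1 = b"
    using assms by (auto simp: theta_def arc_imp_simple_path)
  show "connected (path_image c1 - {a, b})" "path_image c1 - {a, b} \<noteq> {}"
    using connected_simple_path_endless[OF c1(1)] nonempty_simple_path_endless[OF c1(1)] c1 by auto
  \<comment> \<open>The closure of the open parameter interval contains 0 and 1, so by continuity
    both ends are limits of the open arc.\<close>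
  have "c1 ` closure {0<..<1} \<subseteq> closure (c1 ` {0<..<1})"
    using simple_path_imp_path[OF c1(1)]
    by (intro continuous_image_closure_subset[of "{0..1}"]) (auto simp: path_def)
  then show "path_image c1 \<subseteq> closure (path_image c1 - {a, b})"
    using simple_path_endless[OF c1(1)] c1 by (simp add: path_image_def)
qed

text \<open>Each inside is connected and misses the frontier of the other. If they met they would
  therefore be equal, and so would their frontiers; but the open arc of \<open>c2\<close> belongs to
  only one of these.\<close>

lemma theta_insides_disjoint:
  assumes th: "theta a b c1 c2 c3"
    and c3: "path_image c3 \<inter> inside (path_image c1 \<union> path_image c2) = {}"
    and c2: "path_image c2 \<inter> inside (path_image c1 \<union> path_image c3) = {}"
  shows "inside (path_image c1 \<union> path_image c2) \<inter> inside (path_image c1 \<union> path_image c3) = {}"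
proof (rule ccontr)
  let ?A = "inside (path_image c1 \<union> path_image c2)" and ?B = "inside (path_image c1 \<union> path_image c3)"
  assume meet: "?A \<inter> ?B \<noteq> {}"
  have th': "theta a b c1 c3 c2" using th theta_rotate theta_swap by blast
  note A = theta_Jordan[OF th] and B = theta_Jordan[OF th']
  have "?A \<subseteq> ?B"
  proof (rule ccontr)
    assume "\<not> ?A \<subseteq> ?B"
    then have "?A \<inter> frontier ?B \<noteq> {}"
      using connected_Int_frontier[OF A(3) meet] by blast
    then show False using B(5) c3 inside_no_overlap by blast
  qed
  moreover have "?B \<subseteq> ?A"
  proof (rule ccontr)
    assume "\<not> ?B \<subseteq> ?A"
    then have "?B \<inter> frontier ?A \<noteq> {}"
      using connected_Int_frontier[OF B(3), of ?A] meet by blast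
    then show False using A(5) c2 inside_no_overlap by blast
  qed
  ultimately have "?A = ?B" by (rule subset_antisym)
  then have "path_image c2 \<subseteq> path_image c1 \<union> path_image c3"
    using A(5) B(5) by (metis Un_upper2)
  moreover have "path_image c1 \<inter> path_image c2 = {a, b}" "path_image c2 \<inter> path_image c3 = {a, b}"
    using th by (simp_all add: theta_def)
  ultimately show False
    using theta_open_arc(2)[OF theta_rotate[OF th]] by blast
qed

text \<open>
  If every arc were outside, a point \<open>p\<close> inside the first two arcs would be outside each of the other
  two closed curves, and Janiszewski's theorem would connect \<open>p\<close> to infinity off the whole theta.
\<close>

lemma theta_not_all_outside:
  assumes th: "theta a b c1 c2 c3"
    and c3: "path_image c3 \<inter> inside (path_image c1 \<union> path_image c2) = {}"
    and c2: "path_image c2 \<inter> inside (path_image c1 \<union> path_image c3) = {}"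
    and c1: "path_image c1 \<inter> inside (path_image c2 \<union> path_image c3) = {}"
  shows False
proof -
  have th2: "theta a b c1 c3 c2" and th3: "theta a b c2 c3 c1" and th4: "theta a b c2 c1 c3"
    using th theta_rotate theta_swap by blast+
  let ?S = "path_image c1 \<union> path_image c3" and ?T = "path_image c2 \<union> path_image c3"
  obtain p where p: "p \<in> inside (path_image c1 \<union> path_image c2)"
    using theta_Jordan(1)[OF th] by blast
  have "p \<notin> inside ?S"
    using theta_insides_disjoint[OF th c3 c2] p by blast
  moreover have "p \<notin> inside ?T"
    using theta_insides_disjoint[OF th4] c1 c3 p by (auto simp: Un_commute)
  moreover have "p \<notin> ?S \<union> ?T" using p c3 inside_no_overlap by blast
  ultimately have pS: "p \<in> outside ?S" and pT: "p \<in> outside ?T"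
    using inside_Un_outside by blast+
  have "bounded (?S \<union> ?T)"
    using compact_imp_bounded[OF theta_Jordan(6)[OF th2]] compact_imp_bounded[OF theta_Jordan(6)[OF th3]]
    by (subst bounded_Un) simp
  \<comment> \<open>\<open>q\<close> plays the role of infinity.\<close>
  then obtain q where q: "q \<in> outside (?S \<union> ?T)"
    using outside_bounded_nonempty by blast
  have qS: "q \<in> outside ?S" and qT: "q \<in> outside ?T"
    and q12: "q \<in> outside (path_image c1 \<union> path_image c2)"
    by (rule subsetD[OF outside_mono q]; blast)+
  have "connected_component (- (?S \<union> ?T)) p q"
  proof (rule Janiszewski)
    have "?S \<inter> ?T = path_image c3" using th unfolding theta_def by blast
    then show "connected (?S \<inter> ?T)"
      using th by (simp add: theta_def connected_arc_image)
    show "connected_component (- ?S) p q"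
      unfolding connected_component_def
      using theta_Jordan(4)[OF th2] pS qS outside_no_overlap by blast
    show "connected_component (- ?T) p q"
      unfolding connected_component_def
      using theta_Jordan(4)[OF th3] pT qT outside_no_overlap by blast
  qed (use theta_Jordan[OF th2] theta_Jordan[OF th3] in auto)
  then have "connected_component (- (path_image c1 \<union> path_image c2)) p q"
    by (rule connected_component_of_subset) blast
  then have "q \<in> inside (path_image c1 \<union> path_image c2)"
    using p inside_same_component by blast
  then show False using q12 inside_Int_outside by blast
qed

text \<open>An open arc is connected and disjoint from the loop of the other two, so it lies inside
  that loop entirely or not at all. The points \<open>x1\<close> and \<open>x2\<close> keep the
  first two arcs from being inside, and not all three can be outside.\<close>

lemma theta_arc_inside:
  assumes th: "theta a b c1 c2 c3"
    and D: "path_image c1 \<union> path_image c2 \<union> path_image c3 \<subseteq> D"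
    and x1: "x1 \<in> path_image c1" "x1 \<notin> {a, b}" "x1 \<in> frontier (outside D)"
    and x2: "x2 \<in> path_image c2" "x2 \<notin> {a, b}" "x2 \<in> frontier (outside D)"
  shows "path_image c3 - {a, b} \<subseteq> inside (path_image c1 \<union> path_image c2)"
proof -
  have dich: "path_image e1 \<inter> inside (path_image e2 \<union> path_image e3) = {}
      \<or> path_image e1 - {a, b} \<subseteq> inside (path_image e2 \<union> path_image e3)"
    if t: "theta a b e1 e2 e3" for e1 e2 e3
  proof -
    note J = theta_Jordan[OF theta_rotate[OF t]]
    have ab: "{a,b} \<inter> inside (path_image e2 \<union> path_image e3) = {}"
      using t inside_no_overlap[of "path_image e2 \<union> path_image e3"] unfolding theta_def by blast
    have "(path_image e1 - {a,b}) \<inter> frontier (inside (path_image e2 \<union> path_image e3)) = {}"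
      using J(5) t unfolding theta_def by blast
    then show ?thesis
      using connected_Int_frontier[OF theta_open_arc(1)[OF t]] ab by blast
  qed
  have th2: "theta a b c2 c1 c3" and th3: "theta a b c3 c1 c2"
    using th theta_rotate theta_swap by blast+
  have closed: "closed (path_image c2 \<union> path_image c3)" "closed (path_image c1 \<union> path_image c3)"
    using theta_Jordan(7) th theta_rotate theta_swap by blast+
  have "x1 \<notin> inside (path_image c2 \<union> path_image c3)"
    by (rule inside_avoids_frontier_outside[OF _ closed(1) x1(3)]) (use D in auto)
  then have 1: "path_image c1 \<inter> inside (path_image c2 \<union> path_image c3) = {}"
    using dich[OF th] x1 by blast
  have "x2 \<notin> inside (path_image c1 \<union> path_image c3)"
    by (rule inside_avoids_frontier_outside[OF _ closed(2) x2(3)]) (use D in auto)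
  then have 2: "path_image c2 \<inter> inside (path_image c1 \<union> path_image c3) = {}"
    using dich[OF th2] x2 by blast
  show ?thesis
    using dich[OF th3] theta_not_all_outside[OF th _ 2 1] by blast
qed

text \<open>The points on the first two arcs force the third arc inside their loop, while its own
  point keeps it out.\<close>

lemma no_outer_theta:
  assumes th: "theta a b c1 c2 c3"
    and D: "path_image c1 \<union> path_image c2 \<union> path_image c3 \<subseteq> D"
    and x: "x1 \<in> path_image c1" "x2 \<in> path_image c2" "x3 \<in> path_image c3"
      "x1 \<notin> {a, b}" "x2 \<notin> {a, b}" "x3 \<notin> {a, b}"
      "x1 \<in> frontier (outside D)" "x2 \<in> frontier (outside D)" "x3 \<in> frontier (outside D)"
  shows False
proof -
  have "x3 \<in> inside (path_image c1 \<union> path_image c2)"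
    using theta_arc_inside[OF th D] x by blast
  moreover have "x3 \<notin> inside (path_image c1 \<union> path_image c2)"
    by (rule inside_avoids_frontier_outside[OF _ theta_Jordan(7)[OF th] x(9)]) (use D in auto)
  ultimately show False by blast
qed

text \<open>Both chord arcs run inside the common loop, and \<open>e\<close> splits this inside into
  two regions. The open arc of \<open>f\<close> is connected and misses \<open>e\<close>, so it
  stays in one region; but its ends \<open>c\<close> and \<open>d\<close> lie on different sides of
  the loop, and neither region has both in its closure.\<close>

lemma no_outer_crossing:
  assumes e: "theta a b c1 c2 e" and f: "theta c d d1 d2 f"
    and same: "path_image c1 \<union> path_image c2 = path_image d1 \<union> path_image d2"
    and ef: "path_image e \<inter> path_image f = {}"
    and D: "path_image c1 \<union> path_image c2 \<union> path_image e \<union> path_image f \<subseteq> D"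
    and c: "c \<in> path_image c1" "c \<notin> {a, b}" "c \<in> frontier (outside D)"
    and d: "d \<in> path_image c2" "d \<notin> {a, b}" "d \<in> frontier (outside D)"
    and a: "a \<in> path_image d1" "a \<notin> {c, d}" "a \<in> frontier (outside D)"
    and b: "b \<in> path_image d2" "b \<notin> {c, d}" "b \<in> frontier (outside D)"
  shows False
proof -
  let ?C = "path_image c1 \<union> path_image c2"
  let ?I1 = "inside (path_image c1 \<union> path_image e)" and ?I2 = "inside (path_image c2 \<union> path_image e)"
  let ?F = "path_image f - {c, d}"
  have eI: "path_image e - {a, b} \<subseteq> inside ?C"
    by (rule theta_arc_inside[OF e _ c d]) (use D in auto)
  have fI: "?F \<subseteq> inside ?C"
    unfolding same by (rule theta_arc_inside[OF f _ a b]) (use D same in auto)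
  have e1: "theta a b c1 e c2" and e2: "theta a b c2 e c1" and e3: "theta a b e c1 c2"
    using e theta_rotate theta_swap by blast+
  have f3: "theta c d f d1 d2"
    using f theta_rotate theta_swap by blast
  have "path_image e \<inter> inside ?C \<noteq> {}"
    using eI theta_open_arc(2)[OF e3] by blast
  moreover have "a \<noteq> b"
    using e arc_distinct_ends[of c1] by (auto simp: theta_def)
  ultimately obtain split: "?I1 \<inter> ?I2 = {}" "?I1 \<union> ?I2 \<union> (path_image e - {a, b}) = inside ?C"
    using e by (elim split_inside_simple_closed_curve[of c1 a b c2 e, rotated -1])
      (simp_all add: theta_def arc_imp_simple_path)
  have cl: "closure ?I1 \<subseteq> path_image c1 \<union> path_image e \<union> ?I1"
    "closure ?I2 \<subseteq> path_image c2 \<union> path_image e \<union> ?I2"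
    using closure_inside_subset theta_Jordan(7) e1 e2 by blast+
  have F: "?F \<subseteq> ?I1 \<union> ?I2" using fI split(2) ef by blast
  have "?F \<subseteq> ?I1 \<or> ?F \<subseteq> ?I2"
  proof (rule ccontr)
    assume "\<not> (?F \<subseteq> ?I1 \<or> ?F \<subseteq> ?I2)"
    then have "?I1 \<inter> ?F \<noteq> {}" "?I2 \<inter> ?F \<noteq> {}" using F by blast+
    then show False
      using connectedD[OF theta_open_arc(1)[OF f3] theta_Jordan(2)[OF e1] theta_Jordan(2)[OF e2]]
        F split(1) by blast
  qed
  moreover have False if "?F \<subseteq> ?I1"
  proof -
    have "d \<in> closure ?I1"
      using closure_mono[OF that] theta_open_arc(3)[OF f3] f by (auto simp: theta_def)
    moreover have "d \<notin> path_image c1" "d \<notin> path_image e"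
      using d e f ef by (auto simp: theta_def)
    moreover have "d \<notin> ?I1" using d(1) split(2) inside_no_overlap[of ?C] by blast
    ultimately show False using cl(1) by blast
  qed
  moreover have False if "?F \<subseteq> ?I2"
  proof -
    have "c \<in> closure ?I2"
      using closure_mono[OF that] theta_open_arc(3)[OF f3] f by (auto simp: theta_def)
    moreover have "c \<notin> path_image c2" "c \<notin> path_image e"
      using c e f ef by (auto simp: theta_def)
    moreover have "c \<notin> ?I2" using c(1) split(2) inside_no_overlap[of ?C] by blast
    ultimately show False using cl(2) by blast
  qed
  ultimately show False by blast
qed

subsection \<open>Paths and cycles in drawn graphs\<close>

text \<open>A recursive replacement for the index condition in \<open>graph_path\<close>, suited to
  joining and reversing paths; \<open>graph_path_iff\<close> connects the two.\<close>

fun path_edges :: "'a list \<Rightarrow> 'a set set" where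
  "path_edges (x # y # zs) = insert {x, y} (path_edges (y # zs))"
| "path_edges _ = {}"

lemma path_edges_join: "path_edges (xs @ y # zs) = path_edges (xs @ [y]) \<union> path_edges (y # zs)"
  by (induction xs rule: path_edges.induct) (auto simp: insert_commute)

lemma path_edges_rev: "path_edges (rev xs) = path_edges xs"
proof (induction xs rule: path_edges.induct)
  case (1 x y zs)
  then show ?case
    using path_edges_join[of "rev zs" y "[x]"] by (auto simp: insert_commute)
qed auto

lemma Union_path_edges: "2 \<le> length p \<Longrightarrow> \<Union> (path_edges p) = set p"
proof (induction p rule: path_edges.induct)
  case (1 x y zs)
  then show ?case by (cases zs) auto
qed auto

lemma path_edges_subset: "e \<in> path_edges p \<Longrightarrow> e \<subseteq> set p"
  by (induction p rule: path_edges.induct) auto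

text \<open>Only the first edge contains \<open>a\<close>, and \<open>b\<close> comes after the
  second vertex. Hence a long path and the edge between its ends have no edge in common.\<close>

lemma ends_notin_path_edges:
  assumes "distinct p" "3 \<le> length p" "hd p = a" "last p = b"
  shows "{a, b} \<notin> path_edges p"
proof -
  obtain y z zs where p: "p = a # y # z # zs"
    using assms(2,3) by (cases p rule: path_edges.cases; cases "tl (tl p)") auto
  then have "b \<in> set (z # zs)" using assms(4) by auto
  then show ?thesis
    using assms(1) path_edges_subset[of "{a, b}" "y # z # zs"] unfolding p by (auto simp: doubleton_eq_iff)
qed

lemma path_edges_nth: "path_edges p = (\<lambda>i. {p ! i, p ! Suc i}) ` {i. Suc i < length p}"
proof (induction p rule: path_edges.induct)
  case (1 x y zs)
  have "{i. Suc i < length (x # y # zs)} = insert 0 (Suc ` {i. Suc i < length (y # zs)})"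
    by (auto simp: image_iff) (metis Suc_less_eq not0_implies_Suc)
  then show ?case using 1 by (simp add: image_image)
qed auto

lemma graph_path_iff:
  "graph_path G p \<longleftrightarrow> p \<noteq> [] \<and> distinct p \<and> set p \<subseteq> vertices G \<and> path_edges p \<subseteq> edges G"
  by (auto simp: graph_path_def path_edges_nth)

lemma path_leaves_set:
  "p \<noteq> [] \<Longrightarrow> hd p \<in> S \<Longrightarrow> last p \<notin> S \<Longrightarrow> \<exists>x\<in>S. \<exists>y. y \<in> set p \<and> y \<notin> S \<and> {x, y} \<in> path_edges p"
proof (induction p rule: path_edges.induct)
  case (1 x y zs)
  then show ?case by (cases "y \<in> S") auto
qed auto

lemma connected_path:
  assumes "k_connected 2 G" "x \<in> vertices G" "y \<in> vertices G"
  obtains p where "graph_path G p" "hd p = x" "last p = y"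
proof -
  have "graph_connected (induced_subgraph G (vertices G - {}))"
    using assms(1) unfolding k_connected_def by (metis card.empty empty_subsetI zero_less_numeral)
  then obtain p where "graph_path (induced_subgraph G (vertices G)) p" "hd p = x" "last p = y"
    using assms(2,3) unfolding graph_connected_def by (auto simp: induced_subgraph_def)
  then show ?thesis using that by (auto simp: graph_path_def induced_subgraph_def)
qed

lemma connected_path_avoiding:
  assumes "k_connected 2 G" "u \<in> vertices G" "x \<in> vertices G - {u}" "y \<in> vertices G - {u}"
  obtains p where "graph_path G p" "hd p = x" "last p = y" "u \<notin> set p"
proof -
  have "graph_connected (induced_subgraph G (vertices G - {u}))"
    using assms(1,2) unfolding k_connected_def by (metis One_nat_def card_1_singleton_iff empty_subsetI insert_subset one_less_numeral_iff semiring_norm(76))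
  then obtain p where p: "graph_path (induced_subgraph G (vertices G - {u})) p" "hd p = x" "last p = y"
    using assms(3,4) unfolding graph_connected_def by (auto simp: induced_subgraph_def)
  then have "u \<notin> set p" "graph_path G p" by (auto simp: graph_path_def induced_subgraph_def)
  then show ?thesis using that p by blast
qed

section \<open>Cycles in 2-connected graphs\<close>

definition graph_cycle :: "'a ugraph \<Rightarrow> 'a list \<Rightarrow> bool" where
  "graph_cycle G p \<longleftrightarrow> 3 \<le> length p \<and> distinct p \<and> set p \<subseteq> vertices G \<and> path_edges (p @ [hd p]) \<subseteq> edges G"

lemma graph_cycle_rotate:
  assumes "graph_cycle G (xs @ ys)"
  shows "graph_cycle G (ys @ xs)"
proof (cases "xs = [] \<or> ys = []")
  case False
  then obtain x xs' y ys' where eq: "xs = x # xs'" "ys = y # ys'" by (metis neq_Nil_conv)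
  have "path_edges ((ys @ xs) @ [hd (ys @ xs)]) = path_edges ((xs @ ys) @ [hd (xs @ ys)])"
    using path_edges_join[of "x # xs'" y "ys' @ [x]"] path_edges_join[of "y # ys'" x "xs' @ [y]"]
    by (auto simp: eq)
  then show ?thesis using assms by (auto simp: graph_cycle_def)
qed (use assms in auto)

lemma graph_cycle_from:
  assumes "graph_cycle G p" "v \<in> set p"
  obtains q where "graph_cycle G (v # q)" "set (v # q) = set p" "length (v # q) = length p"
proof -
  obtain xs ys where "p = xs @ v # ys" using assms(2) by (meson split_list)
  then show ?thesis using graph_cycle_rotate[of G xs "v # ys"] assms(1) that[of "ys @ xs"] by auto
qed

text \<open>There is a third vertex, and a path to it from \<open>a\<close> that avoids
  \<open>x\<close> must leave \<open>a\<close> along some edge.\<close>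

lemma exists_neighbour_avoiding:
  assumes "k_connected 2 G" "a \<in> vertices G" "x \<in> vertices G" "a \<noteq> x"
  shows "\<exists>y. {a, y} \<in> edges G \<and> y \<in> vertices G \<and> y \<noteq> x \<and> y \<noteq> a"
proof -
  have "\<not> vertices G \<subseteq> {a, x}"
    using assms(1) card_mono[of "{a, x}" "vertices G"] assms(4) by (auto simp: k_connected_def)
  then obtain w where w: "w \<in> vertices G" "w \<noteq> a" "w \<noteq> x" by blast
  obtain p where p: "graph_path G p" "hd p = a" "last p = w" "x \<notin> set p"
    using connected_path_avoiding[OF assms(1,3), of a w] assms w by blast
  then have "\<exists>u\<in>{a}. \<exists>y. y \<in> set p \<and> y \<notin> {a} \<and> {u, y} \<in> path_edges p"
    using w by (intro path_leaves_set) (auto simp: graph_path_def)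
  then show ?thesis using p by (auto simp: graph_path_iff)
qed

text \<open>Two neighbours of \<open>a\<close> are joined by a path avoiding \<open>a\<close>, which
  closes up through \<open>a\<close>.\<close>

lemma exists_graph_cycle:
  assumes "k_connected 2 G"
  obtains p where "graph_cycle G p"
proof -
  have "2 < card (vertices G)" using assms by (simp add: k_connected_def)
  then obtain a b where ab: "a \<in> vertices G" "b \<in> vertices G" "a \<noteq> b"
    by (metis card_2_iff' card_le_Suc0_iff_eq card.infinite leD less_imp_le_nat not_less_eq_eq numeral_2_eq_2 not_less0)
  obtain x where x: "{a, x} \<in> edges G" "x \<in> vertices G" "x \<noteq> a"
    using exists_neighbour_avoiding[OF assms ab] by blast
  obtain y where y: "{a, y} \<in> edges G" "y \<in> vertices G" "y \<noteq> x" "y \<noteq> a"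
    using exists_neighbour_avoiding[OF assms ab(1) x(2)] x by blast
  obtain p where p: "graph_path G p" "hd p = x" "last p = y" "a \<notin> set p"
    using connected_path_avoiding[OF assms ab(1), of x y] x y by blast
  then obtain p' where p': "p = x # p' @ [y]"
    using y(3) by (metis append_butlast_last_id graph_path_def hd_Cons_tl last_ConsL last_tl)
  have "graph_cycle G (a # p)"
    using p path_edges_join[of "x # p'" y "[a]"] x y ab unfolding graph_cycle_def graph_path_iff p'
    by (auto simp: insert_commute)
  then show ?thesis using that by blast
qed

section \<open>Arcs and theta curves drawn by paths\<close>

lemma drawing_edges_Int:
  assumes "plane_drawing G pos \<gamma>" "e \<in> edges G" "e' \<in> edges G" "e \<noteq> e'"
  shows "path_image (\<gamma> e) \<inter> path_image (\<gamma> e') = pos ` (e \<inter> e')"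
  using assms unfolding plane_drawing_def by blast

lemma drawn_path:
  assumes "plane_drawing G pos \<gamma>" "graph_path G p" "2 \<le> length p"
  shows "\<exists>c. arc c \<and> pathstart c = pos (hd p) \<and> pathfinish c = pos (last p) \<and>
    path_image c = (\<Union>e\<in>path_edges p. path_image (\<gamma> e))"
  using assms(2,3)
proof (induction p rule: path_edges.induct)
  case (1 x y zs)
  have xy: "{x, y} \<in> edges G" "x \<noteq> y" "x \<notin> set (y # zs)" and x: "x \<in> vertices G" "y \<in> vertices G"
    using 1(2) by (auto simp: graph_path_iff)
  have g: "arc (\<gamma> {x, y})" "{pathstart (\<gamma> {x, y}), pathfinish (\<gamma> {x, y})} = pos ` {x, y}"
    using assms(1) xy(1) unfolding plane_drawing_def by blast+
  \<comment> \<open>The arc of an edge may run in either direction and is reversed if it starts at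
    \<open>y\<close>.\<close>
  obtain c where c: "arc c" "pathstart c = pos x" "pathfinish c = pos y"
    "path_image c = path_image (\<gamma> {x, y})"
  proof (cases "pathstart (\<gamma> {x, y}) = pos x")
    case True
    then have "pathfinish (\<gamma> {x, y}) = pos y"
      using g arc_distinct_ends[OF g(1)] by (auto simp: doubleton_eq_iff)
    then show ?thesis using that[of "\<gamma> {x, y}"] g True by blast
  next
    case False
    then have "pathstart (\<gamma> {x, y}) = pos y" "pathfinish (\<gamma> {x, y}) = pos x"
      using g by (auto simp: doubleton_eq_iff)
    then show ?thesis using that[of "reversepath (\<gamma> {x, y})"] g by (auto simp: arc_reversepath)
  qed
  show ?case
  proof (cases zs)
    case Nil
    then show ?thesis using c by auto
  next
    case (Cons z zs')
    have gp: "graph_path G (y # zs)" using 1(2) by (auto simp: graph_path_iff)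
    then obtain d where d: "arc d" "pathstart d = pos y" "pathfinish d = pos (last (y # zs))"
      "path_image d = (\<Union>e\<in>path_edges (y # zs). path_image (\<gamma> e))"
      using 1(1) Cons by auto
    \<comment> \<open>Since \<open>x\<close> does not recur on the path, the first edge can share
      only \<open>y\<close> with a later one.\<close>
    have "path_image (\<gamma> {x, y}) \<inter> path_image (\<gamma> e) \<subseteq> {pos y}" if "e \<in> path_edges (y # zs)" for e
    proof -
      have "x \<notin> e" using path_edges_subset[OF that] xy(3) by blast
      moreover have "e \<in> edges G" using gp that by (auto simp: graph_path_iff)
      ultimately have "path_image (\<gamma> {x, y}) \<inter> path_image (\<gamma> e) = pos ` ({x, y} \<inter> e)"
        using drawing_edges_Int[OF assms(1) xy(1)] by blast
      then show ?thesis using \<open>x \<notin> e\<close> by auto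
    qed
    then have "path_image c \<inter> path_image d \<subseteq> {pos y}"
      unfolding c(4) d(4) by blast
    then have "arc (c +++ d)" using c d by (intro arc_join) auto
    moreover have "path_image (c +++ d) = (\<Union>e\<in>path_edges (x # y # zs). path_image (\<gamma> e))"
      using c d by (subst path_image_join) auto
    ultimately show ?thesis
      using c d by (intro exI[of _ "c +++ d"]) auto
  qed
qed auto

lemma drawn_Int:
  assumes "plane_drawing G pos \<gamma>" "A \<subseteq> edges G" "B \<subseteq> edges G" "A \<inter> B = {}"
  shows "(\<Union>e\<in>A. path_image (\<gamma> e)) \<inter> (\<Union>e\<in>B. path_image (\<gamma> e)) = pos ` (\<Union>A \<inter> \<Union>B)"
proof -
  have *: "path_image (\<gamma> e) \<inter> path_image (\<gamma> e') = pos ` (e \<inter> e')" if "e \<in> A" "e' \<in> B" for e e'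
  proof -
    have "e \<in> edges G" "e' \<in> edges G" "e \<noteq> e'" using that assms(2-4) by auto
    then show ?thesis by (rule drawing_edges_Int[OF assms(1)])
  qed
  have "(\<Union>e\<in>A. path_image (\<gamma> e)) \<inter> (\<Union>e\<in>B. path_image (\<gamma> e)) 
      = (\<Union>e\<in>A. \<Union>e'\<in>B. path_image (\<gamma> e) \<inter> path_image (\<gamma> e'))" by blast
  also have "\<dots> = (\<Union>e\<in>A. \<Union>e'\<in>B. pos ` (e \<inter> e'))" using * by simp
  also have "\<dots> = pos ` (\<Union>A \<inter> \<Union>B)" by blast
  finally show ?thesis .
qed

text \<open>A common edge has two ends, both in \<open>{a, b}\<close>, so it would be
  \<open>{a, b}\<close> itself.\<close>

lemma path_edges_disjoint:
  assumes "simple_graph G" "graph_path G p" "graph_path G q" "set p \<inter> set q \<subseteq> {a, b}"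
    and "{a, b} \<notin> path_edges p"
  shows "path_edges p \<inter> path_edges q = {}"
proof (rule ccontr)
  assume "path_edges p \<inter> path_edges q \<noteq> {}"
  then obtain e where e: "e \<in> path_edges p" "e \<in> path_edges q" by blast
  then have "e \<subseteq> {a, b}" using path_edges_subset assms(4) by blast
  moreover have "card e = 2" using e assms(1,2) by (auto simp: graph_path_iff simple_graph_def)
  ultimately have "e = {a, b}"
    by (intro card_seteq) (auto simp: card_insert_if)
  then show False using e assms(5) by simp
qed

text \<open>The third path may be the single edge \<open>{a, b}\<close>, as needed for chords. The
  other two are long, so no two of the paths share an edge and their drawings meet only in the
  common ends.\<close>

lemma drawn_theta:
  assumes G: "simple_graph G" and dr: "plane_drawing G pos \<gamma>"
    and p: "\<And>p. p \<in> {p1, p2, p3} \<Longrightarrow> graph_path G p \<and> 2 \<le> length p \<and> hd p = a \<and> last p = b"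
    and int: "set p1 \<inter> set p2 = {a, b}" "set p1 \<inter> set p3 = {a, b}" "set p2 \<inter> set p3 = {a, b}"
    and long: "3 \<le> length p1" "3 \<le> length p2"
  obtains c1 c2 c3 where "theta (pos a) (pos b) c1 c2 c3"
    "path_image c1 = (\<Union>e\<in>path_edges p1. path_image (\<gamma> e))"
    "path_image c2 = (\<Union>e\<in>path_edges p2. path_image (\<gamma> e))"
    "path_image c3 = (\<Union>e\<in>path_edges p3. path_image (\<gamma> e))"
proof -
  have "\<exists>c. arc c \<and> pathstart c = pos a \<and> pathfinish c = pos b \<and>
      path_image c = (\<Union>e\<in>path_edges p. path_image (\<gamma> e))" if "p \<in> {p1, p2, p3}" for p
    using drawn_path[OF dr, of p] p[OF that] by auto
  then obtain c1 c2 c3 where c: "arc c1" "pathstart c1 = pos a" "pathfinish c1 = pos b"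
      "path_image c1 = (\<Union>e\<in>path_edges p1. path_image (\<gamma> e))"
      "arc c2" "pathstart c2 = pos a" "pathfinish c2 = pos b"
      "path_image c2 = (\<Union>e\<in>path_edges p2. path_image (\<gamma> e))"
      "arc c3" "pathstart c3 = pos a" "pathfinish c3 = pos b"
      "path_image c3 = (\<Union>e\<in>path_edges p3. path_image (\<gamma> e))"
    by (metis insertI1 insertI2)
  have gp: "graph_path G p1" "graph_path G p2" "graph_path G p3" using p by auto
  have "{a, b} \<notin> path_edges p1" "{a, b} \<notin> path_edges p2"
    using ends_notin_path_edges[of p1] ends_notin_path_edges[of p2] p[of p1] p[of p2] long
    by (simp_all add: graph_path_def)
  then have dis: "path_edges p1 \<inter> path_edges p2 = {}" "path_edges p1 \<inter> path_edges p3 = {}"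
    "path_edges p2 \<inter> path_edges p3 = {}"
    using path_edges_disjoint[OF G] gp int by blast+
  have sub: "path_edges p1 \<subseteq> edges G" "path_edges p2 \<subseteq> edges G" "path_edges p3 \<subseteq> edges G"
    using gp by (auto simp: graph_path_iff)
  have U: "\<Union>(path_edges p1) = set p1" "\<Union>(path_edges p2) = set p2" "\<Union>(path_edges p3) = set p3"
    using Union_path_edges p by auto
  have "theta (pos a) (pos b) c1 c2 c3"
    using c drawn_Int[OF dr sub(1,2) dis(1)] drawn_Int[OF dr sub(1,3) dis(2)]
      drawn_Int[OF dr sub(2,3) dis(3)] unfolding theta_def U int by simp
  then show ?thesis using that c by blast
qed

lemma pos_in_drawn:
  assumes "plane_drawing G pos \<gamma>" "graph_path G p" "2 \<le> length p" "x \<in> set p"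
  shows "pos x \<in> (\<Union>e\<in>path_edges p. path_image (\<gamma> e))"
proof -
  obtain e where "e \<in> path_edges p" "x \<in> e" using Union_path_edges[OF assms(3)] assms(4) by blast
  moreover have "e \<in> edges G" using assms(2) calculation by (auto simp: graph_path_iff)
  then have "pos ` e \<subseteq> path_image (\<gamma> e)" using assms(1) unfolding plane_drawing_def by blast
  ultimately show ?thesis by blast
qed

subsection \<open>Hamiltonian cycles of outerplanar graphs\<close>

definition outer_drawing ::
    "'a ugraph \<Rightarrow> ('a \<Rightarrow> complex) \<Rightarrow> ('a set \<Rightarrow> real \<Rightarrow> complex) \<Rightarrow> bool" where
  "outer_drawing G pos \<gamma> \<longleftrightarrow> plane_drawing G pos \<gamma> \<and>
     (\<forall>v\<in>vertices G. pos v \<in> frontier (outside (drawing_image G pos \<gamma>)))"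

lemma exists_interior_vertex:
  assumes "distinct p" "3 \<le> length p"
  obtains x where "x \<in> set p" "x \<noteq> a" "x \<noteq> b"
proof -
  have "\<not> set p \<subseteq> {a, b}"
  proof
    assume "set p \<subseteq> {a, b}"
    then have "card (set p) \<le> card {a, b}" by (intro card_mono) auto
    then show False
      using assms distinct_card[of p] card_insert_le_m1[of 2 "{b}" a] by (simp add: card_insert_if split: if_splits)
  qed
  then show ?thesis using that by blast
qed

text \<open>Such paths form a subdivision of K_{2,3}. Each of them has an inner vertex, which an
  outer drawing puts on the frontier of the outer face.\<close>

lemma no_three_long_paths:
  assumes G: "simple_graph G" and dr: "outer_drawing G pos \<gamma>"
    and p: "\<And>p. p \<in> {p1, p2, p3} \<Longrightarrow> graph_path G p \<and> 3 \<le> length p \<and> hd p = a \<and> last p = b"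
    and int: "set p1 \<inter> set p2 = {a, b}" "set p1 \<inter> set p3 = {a, b}" "set p2 \<inter> set p3 = {a, b}"
  shows False
proof -
  have pd: "plane_drawing G pos \<gamma>" using dr by (simp add: outer_drawing_def)
  have p': "graph_path G p \<and> 2 \<le> length p \<and> hd p = a \<and> last p = b" if "p \<in> {p1, p2, p3}" for p
    using p[OF that] by auto
  have long: "3 \<le> length p1" "3 \<le> length p2" using p by auto
  obtain c1 c2 c3 where th: "theta (pos a) (pos b) c1 c2 c3"
    and c: "path_image c1 = (\<Union>e\<in>path_edges p1. path_image (\<gamma> e))"
    "path_image c2 = (\<Union>e\<in>path_edges p2. path_image (\<gamma> e))"
    "path_image c3 = (\<Union>e\<in>path_edges p3. path_image (\<gamma> e))"
    using drawn_theta[OF G pd p' int long] by blast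
  have ab: "a \<in> vertices G" "b \<in> vertices G"
    using p[of p1] int(1) by (auto simp: graph_path_def)
  have ex: "\<exists>x. pos x \<in> (\<Union>e\<in>path_edges p. path_image (\<gamma> e)) \<and> pos x \<notin> {pos a, pos b} \<and>
      pos x \<in> frontier (outside (drawing_image G pos \<gamma>))" if pp: "p \<in> {p1, p2, p3}" for p
  proof -
    have gp: "graph_path G p" "3 \<le> length p" using p[OF pp] by auto
    obtain x where x: "x \<in> set p" "x \<noteq> a" "x \<noteq> b"
      using exists_interior_vertex[of p a b] gp by (auto simp: graph_path_def)
    then have "x \<in> vertices G" using gp by (auto simp: graph_path_def)
    moreover have "inj_on pos (vertices G)" using pd by (simp add: plane_drawing_def)
    ultimately have "pos x \<notin> {pos a, pos b}" using x ab by (auto dest: inj_onD)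
    moreover have "pos x \<in> frontier (outside (drawing_image G pos \<gamma>))"
      using dr \<open>x \<in> vertices G\<close> by (simp add: outer_drawing_def)
    ultimately show ?thesis
      using pos_in_drawn[OF pd gp(1) _ x(1)] gp(2) by auto
  qed
  have "path_edges p1 \<union> path_edges p2 \<union> path_edges p3 \<subseteq> edges G"
    using p by (auto simp: graph_path_iff)
  then have D: "path_image c1 \<union> path_image c2 \<union> path_image c3 \<subseteq> drawing_image G pos \<gamma>"
    unfolding c drawing_image_def by blast
  obtain x1 x2 x3 where "pos x1 \<in> path_image c1" "pos x1 \<notin> {pos a, pos b}"
      "pos x1 \<in> frontier (outside (drawing_image G pos \<gamma>))"
      "pos x2 \<in> path_image c2" "pos x2 \<notin> {pos a, pos b}"
      "pos x2 \<in> frontier (outside (drawing_image G pos \<gamma>))"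
      "pos x3 \<in> path_image c3" "pos x3 \<notin> {pos a, pos b}"
      "pos x3 \<in> frontier (outside (drawing_image G pos \<gamma>))"
    unfolding c using ex by (metis insertI1 insertI2)
  then show False using no_outer_theta[OF th D] by blast
qed

lemma path_edges_cycle_split:
  "path_edges (u # r1 @ z # r2 @ [u]) = path_edges (u # r1 @ [z]) \<union> path_edges (u # rev r2 @ [z])"
  using path_edges_join[of "u # r1" z "r2 @ [u]"] path_edges_rev[of "z # r2 @ [u]"] by simp

text \<open>A path from the cycle to \<open>x\<close> leaves the cycle along an edge
  \<open>{u, y}\<close>. After deleting \<open>u\<close>, a path leads from \<open>y\<close> back to
  the cycle; cut at its first cycle vertex \<open>z\<close>, it completes an ear from
  \<open>u\<close> to \<open>z\<close>. The cycle is rotated to start at \<open>u\<close>.\<close>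

lemma exists_ear:
  assumes G: "k_connected 2 G" and cyc: "graph_cycle G p" and x: "x \<in> vertices G" "x \<notin> set p"
  obtains u r1 z r2 q where "graph_cycle G (u # r1 @ z # r2)" "length (u # r1 @ z # r2) = length p"
    "graph_path G (u # q @ [z])" "q \<noteq> []" "set q \<inter> set (u # r1 @ z # r2) = {}"
proof -
  have p: "p \<noteq> []" "set p \<subseteq> vertices G" using cyc by (auto simp: graph_cycle_def)
  then have "hd p \<in> vertices G" by (meson hd_in_set subsetD)
  then obtain s where s: "graph_path G s" "hd s = hd p" "last s = x"
    using connected_path[OF G _ x(1)] by blast
  obtain u y where uy: "u \<in> set p" "y \<in> set s" "y \<notin> set p" "{u, y} \<in> path_edges s"
    using path_leaves_set[of s "set p"] s x p by (auto simp: graph_path_def)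
  have y: "y \<in> vertices G" "{u, y} \<in> edges G" "y \<noteq> u"
    using uy s by (auto simp: graph_path_iff)
  obtain r where r: "graph_cycle G (u # r)" "set (u # r) = set p" "length (u # r) = length p"
    using graph_cycle_from[OF cyc uy(1)] by blast
  then obtain w r' where w: "r = w # r'" by (cases r) (auto simp: graph_cycle_def)
  have u: "u \<in> vertices G" "w \<in> vertices G - {u}" using r(1) by (auto simp: graph_cycle_def w)
  obtain t where t: "graph_path G t" "hd t = y" "last t = w" "u \<notin> set t"
    using connected_path_avoiding[OF G u(1), of y w] u y by blast
  have "\<exists>z\<in>set t. z \<in> set (u # r)"
    using t(1,3) w by (intro bexI[of _ w]) (auto simp: graph_path_def)
  then obtain q z t' where q: "t = q @ z # t'" "z \<in> set (u # r)" "\<forall>v\<in>set q. v \<notin> set (u # r)"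
    using split_list_first_prop[of t "\<lambda>v. v \<in> set (u # r)"] by blast
  have qn: "q \<noteq> []" using q t(2) uy(3) r(2) by auto
  have "z \<in> set r" using q t(4) by auto
  then obtain r1 r2 where r12: "r = r1 @ z # r2" by (meson split_list)
  have hq: "hd q = y" using q(1) qn t(2) by simp
  have "path_edges (u # q @ [z]) \<subseteq> insert {u, y} (path_edges t)"
    using path_edges_join[of q z t'] qn hq by (cases q) (auto simp: q(1))
  moreover have "distinct (u # q @ [z])" using t q by (auto simp: graph_path_def)
  moreover have "set (u # q @ [z]) \<subseteq> vertices G" using t q u by (auto simp: graph_path_def)
  ultimately have "graph_path G (u # q @ [z])"
    using t(1) y(2) unfolding graph_path_iff by auto
  moreover have "set q \<inter> set (u # r1 @ z # r2) = {}" using q(3) r12 by auto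
  ultimately show ?thesis using that r(1,3) qn unfolding r12 by blast
qed

lemma longest_cycle_Hamiltonian:
  assumes G: "simple_graph G" and con: "k_connected 2 G" and dr: "outer_drawing G pos \<gamma>"
    and cyc: "graph_cycle G p" and longest: "\<And>q. graph_cycle G q \<Longrightarrow> length q \<le> length p"
  shows "set p = vertices G"
proof (rule ccontr)
  assume "set p \<noteq> vertices G"
  then obtain x where "x \<in> vertices G" "x \<notin> set p" using cyc by (auto simp: graph_cycle_def)
  then obtain u r1 z r2 q where c: "graph_cycle G (u # r1 @ z # r2)" "length (u # r1 @ z # r2) = length p"
    and q: "graph_path G (u # q @ [z])" "q \<noteq> []" and dis: "set q \<inter> set (u # r1 @ z # r2) = {}"
    using exists_ear[OF con cyc] by blast
  have E: "path_edges (u # r1 @ [z]) \<subseteq> edges G" "path_edges (u # rev r2 @ [z]) \<subseteq> edges G"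
    "path_edges (u # q @ [z]) \<subseteq> edges G"
    using c(1) q(1) path_edges_cycle_split[of u r1 z r2] by (auto simp: graph_cycle_def graph_path_iff)
  have V: "set (u # r1 @ z # r2) \<subseteq> vertices G" "distinct (u # r1 @ z # r2)"
    "set q \<subseteq> vertices G" "distinct q"
    using c(1) q(1) by (auto simp: graph_cycle_def graph_path_iff)
  have "length q > 0" using q(2) by simp
  \<comment> \<open>If \<open>z\<close> followed \<open>u\<close> directly, the detour through the
    ear would give a longer cycle.\<close>
  have "r1 \<noteq> []"
  proof
    assume "r1 = []"
    then have "graph_cycle G (u # q @ z # r2)"
      using E V dis q(2) path_edges_cycle_split[of u q z r2]
      by (cases q) (auto simp: graph_cycle_def)
    then show False using longest[of "u # q @ z # r2"] c(2) \<open>r1 = []\<close> \<open>length q > 0\<close> by simp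
  qed
  \<comment> \<open>The same on the other side, where the ear is traversed backwards from
    \<open>z\<close> to \<open>u\<close>.\<close>
  moreover have "r2 \<noteq> []"
  proof
    assume "r2 = []"
    then have "graph_cycle G (u # r1 @ z # rev q)"
      using E V dis q(2) path_edges_cycle_split[of u r1 z "rev q"]
      by (cases q) (auto simp: graph_cycle_def)
    then show False using longest[of "u # r1 @ z # rev q"] c(2) \<open>r2 = []\<close> \<open>length q > 0\<close> by simp
  qed
  moreover have "graph_path G (u # r1 @ [z])" "graph_path G (u # rev r2 @ [z])"
    using E V by (auto simp: graph_path_iff)
  ultimately show False
    using no_three_long_paths[OF G dr, of "u # r1 @ [z]" "u # rev r2 @ [z]" "u # q @ [z]" u z] q V dis
    by (force simp: Suc_le_eq)
qed

lemma exists_Hamiltonian_cycle: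
  assumes G: "simple_graph G" and con: "k_connected 2 G" and dr: "outer_drawing G pos \<gamma>"
  obtains p where "graph_cycle G p" "set p = vertices G"
proof -
  obtain p0 where p0: "graph_cycle G p0" using exists_graph_cycle[OF con] by blast
  have "length q < Suc (card (vertices G))" if "graph_cycle G q" for q
    using that G card_mono[of "vertices G" "set q"] distinct_card[of q]
    by (auto simp: graph_cycle_def simple_graph_def less_Suc_eq_le)
  then obtain p where "graph_cycle G p" "\<And>q. graph_cycle G q \<Longrightarrow> length q \<le> length p"
    using ex_has_greatest_nat[of "graph_cycle G" p0 length "Suc (card (vertices G))"] p0 by blast
  then show ?thesis using that longest_cycle_Hamiltonian[OF G con dr] by blast
qed

text \<open>The cycle is split into two paths once at \<open>a\<close>, \<open>b\<close> and once at
  \<open>c\<close>, \<open>d\<close>. With the chords this gives two thetas on the same closed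
  curve, the situation of \<open>no_outer_crossing\<close>.\<close>

lemma no_crossing_chords:
  assumes G: "simple_graph G" and dr: "outer_drawing G pos \<gamma>"
    and cyc: "graph_cycle G (a # P @ c # Q @ b # R @ d # S)"
    and ab: "{a, b} \<in> edges G" and cd: "{c, d} \<in> edges G"
  shows False
proof -
  have pd: "plane_drawing G pos \<gamma>" using dr by (simp add: outer_drawing_def)
  \<comment> \<open>\<open>?p1\<close>, \<open>?p2\<close> are the two sides between
    \<open>a\<close> and \<open>b\<close>, and \<open>?q1\<close>, \<open>?q2\<close> those between
    \<open>c\<close> and \<open>d\<close>. The quarters \<open>?E1\<close> to \<open>?E4\<close>
    show that both splittings cover the same edges.\<close>
  let ?p1 = "a # P @ c # Q @ [b]" and ?p2 = "a # rev S @ d # rev R @ [b]"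
  let ?q1 = "c # rev P @ a # rev S @ [d]" and ?q2 = "c # Q @ b # R @ [d]"
  let ?E1 = "path_edges (a # P @ [c])" and ?E2 = "path_edges (c # Q @ [b])"
  let ?E3 = "path_edges (b # R @ [d])" and ?E4 = "path_edges (d # S @ [a])"
  have V: "distinct (a # P @ c # Q @ b # R @ d # S)" "set (a # P @ c # Q @ b # R @ d # S) \<subseteq> vertices G"
    using cyc by (auto simp: graph_cycle_def)
  have p1: "path_edges ?p1 = ?E1 \<union> ?E2"
    using path_edges_join[of "a # P" c "Q @ [b]"] by simp
  have p2: "path_edges ?p2 = ?E3 \<union> ?E4"
    using path_edges_join[of "b # R" d "S @ [a]"] path_edges_rev[of "b # R @ d # S @ [a]"] by simp
  have q1: "path_edges ?q1 = ?E4 \<union> ?E1"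
    using path_edges_join[of "d # S" a "P @ [c]"] path_edges_rev[of "d # S @ a # P @ [c]"] by simp
  have q2: "path_edges ?q2 = ?E2 \<union> ?E3"
    using path_edges_join[of "c # Q" b "R @ [d]"] by simp
  have "path_edges (a # P @ c # Q @ b # R @ d # S @ [a]) = ?E1 \<union> ?E2 \<union> ?E3 \<union> ?E4"
    using path_edges_join[of "a # P" c "Q @ b # R @ d # S @ [a]"]
      path_edges_join[of "c # Q" b "R @ d # S @ [a]"] path_edges_join[of "b # R" d "S @ [a]"] by auto
  then have "?E1 \<union> ?E2 \<union> ?E3 \<union> ?E4 \<subseteq> edges G"
    using cyc by (simp add: graph_cycle_def)
  then have gp: "graph_path G ?p1" "graph_path G ?p2" "graph_path G [a, b]"
      "graph_path G ?q1" "graph_path G ?q2" "graph_path G [c, d]"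
    using V ab cd unfolding graph_path_iff p1 p2 q1 q2 by auto
  have h1: "graph_path G p \<and> 2 \<le> length p \<and> hd p = a \<and> last p = b" if "p \<in> {?p1, ?p2, [a, b]}" for p
    using that gp(1-3) by auto
  have h2: "set ?p1 \<inter> set ?p2 = {a, b}" "set ?p1 \<inter> set [a, b] = {a, b}"
      "set ?p2 \<inter> set [a, b] = {a, b}"
    using V by auto
  have h3: "3 \<le> length ?p1" "3 \<le> length ?p2" by simp_all
  obtain c1 c2 e where th1: "theta (pos a) (pos b) c1 c2 e"
    and c: "path_image c1 = (\<Union>e\<in>path_edges ?p1. path_image (\<gamma> e))"
    "path_image c2 = (\<Union>e\<in>path_edges ?p2. path_image (\<gamma> e))"
    "path_image e = (\<Union>e\<in>path_edges [a, b]. path_image (\<gamma> e))"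
    using drawn_theta[OF G pd h1 h2 h3] by blast
  have i1: "graph_path G p \<and> 2 \<le> length p \<and> hd p = c \<and> last p = d" if "p \<in> {?q1, ?q2, [c, d]}" for p
    using that gp(4-6) by auto
  have i2: "set ?q1 \<inter> set ?q2 = {c, d}" "set ?q1 \<inter> set [c, d] = {c, d}"
      "set ?q2 \<inter> set [c, d] = {c, d}"
    using V by auto
  have i3: "3 \<le> length ?q1" "3 \<le> length ?q2" by simp_all
  obtain d1 d2 f where th2: "theta (pos c) (pos d) d1 d2 f"
    and d: "path_image d1 = (\<Union>e\<in>path_edges ?q1. path_image (\<gamma> e))"
    "path_image d2 = (\<Union>e\<in>path_edges ?q2. path_image (\<gamma> e))"
    "path_image f = (\<Union>e\<in>path_edges [c, d]. path_image (\<gamma> e))"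
    using drawn_theta[OF G pd i1 i2 i3] by blast
  have same: "path_image c1 \<union> path_image c2 = path_image d1 \<union> path_image d2"
    unfolding c d p1 p2 q1 q2 by blast
  have "{a, b} \<noteq> {c, d}" "{a, b} \<inter> {c, d} = {}" using V by auto
  then have ef: "path_image e \<inter> path_image f = {}"
    using drawing_edges_Int[OF pd ab cd] unfolding c d by simp
  have sub: "\<Union> (path_image ` \<gamma> ` edges G) \<subseteq> drawing_image G pos \<gamma>" by (auto simp: drawing_image_def)
  have D: "path_image c1 \<union> path_image c2 \<union> path_image e \<union> path_image f \<subseteq> drawing_image G pos \<gamma>"
    using gp(1-3,6) sub unfolding c d graph_path_iff by blast
  have inj: "pos x \<noteq> pos y" if "x \<in> {a, b}" "y \<in> {c, d}" for x y
  proof -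
    have "x \<in> vertices G" "y \<in> vertices G" "x \<noteq> y" using that V by auto
    then show ?thesis using pd unfolding plane_drawing_def by (meson inj_onD)
  qed
  have on: "pos c \<in> path_image c1" "pos d \<in> path_image c2" "pos a \<in> path_image d1" "pos b \<in> path_image d2"
    unfolding c d by (rule pos_in_drawn[OF pd]; use gp in simp)+
  have fr: "pos x \<in> frontier (outside (drawing_image G pos \<gamma>))" if "x \<in> {a, b, c, d}" for x
    using dr that V unfolding outer_drawing_def by auto
  show False
    by (rule no_outer_crossing[OF th1 th2 same ef D]; use on fr inj in fastforce)
qed

subsection \<open>Colorings from labellings\<close>

text \<open>
  The two inner vertices of a red path with 3 edges would both be centres.
\<close>

lemma crumby_coloring_of_labels:
  assumes G: "simple_graph G"
    and adm: "\<And>w. w \<in> vertices G \<Longrightarrow>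
      \<exists>ws. set ws = {x. {w, x} \<in> edges G} \<and> admissible (lab w) (map lab ws)"
  shows "crumby_coloring G (\<lambda>w. if lab w = Bl then Blue else Red)"
proof -
  let ?f = "\<lambda>w. if lab w = Bl then Blue else Red"
  have E: "x \<in> vertices G" "y \<in> vertices G" "x \<noteq> y" if "{x, y} \<in> edges G" for x y
    using G that unfolding simple_graph_def by (auto dest!: bspec[of _ _ "{x, y}"])
  have fin: "finite (edges G)"
    using G by (auto simp: simple_graph_def intro!: finite_subset[of "edges G" "Pow (vertices G)"])
  have ends: "\<exists>x. e = {w, x}" if "e \<in> edges G" "w \<in> e" for e w
    using G that unfolding simple_graph_def by (metis card_2_iff insertE insert_commute singletonD)
  have blue: "x = y" if h: "lab w = Bl" "{w, x} \<in> edges G" "{w, y} \<in> edges G" "lab x = Bl" "lab y = Bl" for w x y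
  proof (rule ccontr)
    assume "x \<noteq> y"
    obtain ws where ws: "set ws = {x. {w, x} \<in> edges G}" "admissible (lab w) (map lab ws)"
      using adm E(1)[OF h(2)] by blast
    \<comment> \<open>\<open>ws\<close> may repeat a neighbour, but its length still bounds the
      number of distinct ones.\<close>
    have "{x, y} \<subseteq> set (filter (\<lambda>x. lab x = Bl) ws)" using h ws(1) by auto
    then have "card {x, y} \<le> card (set (filter (\<lambda>x. lab x = Bl) ws))" by (intro card_mono) auto
    also have "\<dots> \<le> length (filter (\<lambda>x. lab x = Bl) ws)" by (rule card_length)
    also have "\<dots> = length (filter (\<lambda>l. l = Bl) (map lab ws))" by (simp add: filter_map comp_def)
    also have "\<dots> \<le> 1" using ws(2) h(1) by simp
    finally show False using \<open>x \<noteq> y\<close> by simp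
  qed
  have red: "\<exists>x. {w, x} \<in> edges G \<and> lab x \<noteq> Bl" if h: "w \<in> vertices G" "lab w \<noteq> Bl" for w
  proof -
    obtain ws where ws: "set ws = {x. {w, x} \<in> edges G}" "admissible (lab w) (map lab ws)"
      using adm h(1) by blast
    have "\<exists>l\<in>set (map lab ws). l \<noteq> Bl"
    proof (cases "lab w")
      case Lf
      then have "Ct \<in> set (filter (\<lambda>l. l \<noteq> Bl) (map lab ws))" using ws(2) by simp
      then have "Ct \<in> set (map lab ws)" by (meson filter_is_subset subsetD)
      then show ?thesis by (rule bexI[rotated]) simp
    qed (use ws(2) h(2) in auto)
    then show ?thesis using ws(1) by auto
  qed
  have leaf: "x = y" if h: "lab w = Lf" "{w, x} \<in> edges G" "{w, y} \<in> edges G" "lab x \<noteq> Bl" "lab y \<noteq> Bl" for w x y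
  proof (rule ccontr)
    assume "x \<noteq> y"
    obtain ws where ws: "set ws = {x. {w, x} \<in> edges G}" "admissible (lab w) (map lab ws)"
      using adm E(1)[OF h(2)] by blast
    have "{x, y} \<subseteq> set (filter (\<lambda>x. lab x \<noteq> Bl) ws)" using h ws(1) by auto
    then have "card {x, y} \<le> card (set (filter (\<lambda>x. lab x \<noteq> Bl) ws))" by (intro card_mono) auto
    also have "\<dots> \<le> length (filter (\<lambda>x. lab x \<noteq> Bl) ws)" by (rule card_length)
    also have "\<dots> = length (filter (\<lambda>l. l \<noteq> Bl) (map lab ws))" by (simp add: filter_map comp_def)
    also have "\<dots> = 1" using ws(2) h(1) by simp
    finally show False using \<open>x \<noteq> y\<close> by simp
  qed
  have centre: "lab x \<noteq> Ct" if h: "lab w = Ct" "{w, x} \<in> edges G" for w x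
  proof -
    obtain ws where ws: "set ws = {x. {w, x} \<in> edges G}" "admissible (lab w) (map lab ws)"
      using adm E(1)[OF h(2)] by blast
    then show ?thesis using h by force
  qed
  have deg: "vertex_degree (color_subgraph G ?f c) w =
      card {e \<in> edges G. w \<in> e \<and> e \<subseteq> {x \<in> vertices G. ?f x = c}}" for c w
    by (auto simp: vertex_degree_def color_subgraph_def induced_subgraph_def intro!: arg_cong[where f = card])
  have "vertex_degree (color_subgraph G ?f Blue) w \<le> 1" for w
  proof -
    have "e = e'" if e: "e \<in> edges G" "w \<in> e" "\<forall>x\<in>e. lab x = Bl"
      and e': "e' \<in> edges G" "w \<in> e'" "\<forall>x\<in>e'. lab x = Bl" for e e'
    proof -
      obtain x y where "e = {w, x}" "e' = {w, y}" using ends e e' by meson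
      then show ?thesis using blue[of w x y] e e' by auto
    qed
    then have "\<forall>e\<in>{e \<in> edges G. w \<in> e \<and> e \<subseteq> {x \<in> vertices G. ?f x = Blue}}.
        \<forall>e'\<in>{e \<in> edges G. w \<in> e \<and> e \<subseteq> {x \<in> vertices G. ?f x = Blue}}. e = e'"
      by (simp split: if_splits) (metis (mono_tags, lifting) color.distinct(1) mem_Collect_eq subset_iff)
    then show ?thesis
      unfolding deg using fin by (simp add: card_le_Suc0_iff_eq)
  qed
  moreover have "1 \<le> vertex_degree (color_subgraph G ?f Red) w"
    if "w \<in> vertices (color_subgraph G ?f Red)" for w
  proof -
    have w: "w \<in> vertices G" "lab w \<noteq> Bl"
      using that by (auto simp: color_subgraph_def induced_subgraph_def split: if_splits)
    obtain x where x: "{w, x} \<in> edges G" "lab x \<noteq> Bl" using red w by blast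
    then have "{w, x} \<in> {e \<in> edges G. w \<in> e \<and> e \<subseteq> {x \<in> vertices G. ?f x = Red}}"
      using w E by auto
    moreover have "finite {e \<in> edges G. w \<in> e \<and> e \<subseteq> {x \<in> vertices G. ?f x = Red}}"
      using fin by (rule rev_finite_subset) blast
    ultimately show ?thesis
      unfolding deg by (metis (no_types, lifting) One_nat_def Suc_leI card_gt_0_iff empty_iff)
  qed
  moreover have False if p: "graph_path (color_subgraph G ?f Red) p" "length p - 1 = 3" for p
  proof -
    have d: "distinct p" "length p = 4" using p by (auto simp: graph_path_def)
    have e: "{p ! i, p ! Suc i} \<in> edges G" if "i < 3" for i
      using p(1) that d(2) by (auto simp: graph_path_def color_subgraph_def induced_subgraph_def)
    have V: "set p \<subseteq> vertices (color_subgraph G ?f Red)" using p(1) by (simp add: graph_path_def)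
    have r: "lab (p ! i) \<noteq> Bl" if "i < 4" for i
    proof -
      have "p ! i \<in> vertices (color_subgraph G ?f Red)" using V nth_mem[of i p] that d(2) by auto
      then show ?thesis by (simp add: color_subgraph_def induced_subgraph_def split: if_splits)
    qed
    \<comment> \<open>An inner vertex of the path has two distinct red neighbours, so it is not a
      leaf.\<close>
    have "lab (p ! i) = Ct" if "i = 1 \<or> i = 2" for i
    proof -
      have "i - 1 < length p" "i + 1 < length p" "i - 1 \<noteq> i + 1" using d(2) that by auto
      then have ne: "p ! (i - 1) \<noteq> p ! (i + 1)" using d(1) nth_eq_iff_index_eq by metis
      have si: "Suc (i - 1) = i" "i + 1 = Suc i" "i - 1 < 3" "i < 3" "i - 1 < 4" "i < 4" "Suc i < 4"
        using that by auto
      have adj: "{p ! i, p ! (i - 1)} \<in> edges G" "{p ! i, p ! (i + 1)} \<in> edges G"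
        using e[OF si(3)] e[OF si(4)] unfolding si(1,2) by (simp_all add: insert_commute)
      have reds: "lab (p ! (i - 1)) \<noteq> Bl" "lab (p ! (i + 1)) \<noteq> Bl" "lab (p ! i) \<noteq> Bl"
        using r[OF si(5)] r[OF si(6)] r[OF si(7)] unfolding si(2) by simp_all
      have "lab (p ! i) \<noteq> Lf"
        using leaf[OF _ adj reds(1,2)] ne by blast
      then show ?thesis using reds(3) by (cases "lab (p ! i)") simp_all
    qed
    then show False using centre[of "p ! 1" "p ! Suc 1"] e[of 1] by (simp add: numeral_2_eq_2)
  qed
  ultimately show ?thesis unfolding crumby_coloring_def by blast
qed

section \<open>Positions and chords along a Hamiltonian cycle\<close>

lemma four_positions:
  assumes "i < j" "j < k" "k < l" "l < length p"
  obtains P Q R S T where "p = T @ p ! i # P @ p ! j # Q @ p ! k # R @ p ! l # S"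
proof -
  have step: "\<exists>P. drop (Suc a) p = P @ p ! b # drop (Suc b) p" if "a < b" "b < length p" for a b
    using that by (intro exI[of _ "take (b - Suc a) (drop (Suc a) p)"])
      (metis Cons_nth_drop_Suc Suc_leI append_take_drop_id drop_drop le_add_diff_inverse2)
  obtain P Q R where "drop (Suc i) p = P @ p ! j # drop (Suc j) p"
      "drop (Suc j) p = Q @ p ! k # drop (Suc k) p" "drop (Suc k) p = R @ p ! l # drop (Suc l) p"
    using step[of i j] step[of j k] step[of k l] assms by auto
  moreover have "p = take i p @ p ! i # drop (Suc i) p"
    using assms by (simp add: id_take_nth_drop)
  ultimately show ?thesis using that by metis
qed

text \<open>Positions on a cycle are counted from 1, so that a labelling may also speak about the
  positions \<open>0\<close> and \<open>length p + 1\<close>, which denote the last and the first vertex.\<close>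

definition cyc_at :: "'a list \<Rightarrow> nat \<Rightarrow> 'a" where
  "cyc_at p k = p ! ((k + length p - 1) mod length p)"

text \<open>The excluded pairs are the edges of the cycle; \<open>{1, length p}\<close> is the
  closing one.\<close>

definition chord_between :: "'a ugraph \<Rightarrow> 'a list \<Rightarrow> nat \<Rightarrow> nat \<Rightarrow> bool" where
  "chord_between G p i j \<longleftrightarrow> i \<in> {1..length p} \<and> j \<in> {1..length p} \<and> i \<noteq> j \<and> j \<noteq> i + 1 \<and> i \<noteq> j + 1
     \<and> {i, j} \<noteq> {1, length p} \<and> {cyc_at p i, cyc_at p j} \<in> edges G"

text \<open>A position without a chord is its own mate, the convention of \<open>labelled\<close>.
  In a subcubic graph the choice is determined by \<open>chord_between_unique\<close>.\<close>

definition mate :: "'a ugraph \<Rightarrow> 'a list \<Rightarrow> nat \<Rightarrow> nat" where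
  "mate G p i = (if \<exists>j. chord_between G p i j then SOME j. chord_between G p i j else i)"

lemma cyc_at_nth: "k \<in> {1..length p} \<Longrightarrow> cyc_at p k = p ! (k - 1)"
proof -
  assume k: "k \<in> {1..length p}"
  then have eq: "k + length p - 1 = (k - 1) + length p" by auto
  have "k - 1 < length p" using k by auto
  then show ?thesis unfolding cyc_at_def eq mod_add_self2 by simp
qed

lemma cyc_at_0: "p \<noteq> [] \<Longrightarrow> cyc_at p 0 = cyc_at p (length p)"
proof -
  assume "p \<noteq> []"
  then have "length p + length p - 1 = (0 + length p - 1) + length p" by (cases p) auto
  then show ?thesis unfolding cyc_at_def by (metis mod_add_self2)
qed

lemma cyc_at_Suc_length: "p \<noteq> [] \<Longrightarrow> cyc_at p (length p + 1) = cyc_at p 1"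
  by (simp add: cyc_at_def)

lemma cyc_at_eq_iff:
  "distinct p \<Longrightarrow> i \<in> {1..length p} \<Longrightarrow> j \<in> {1..length p} \<Longrightarrow> cyc_at p i = cyc_at p j \<longleftrightarrow> i = j"
  by (auto simp: cyc_at_nth nth_eq_iff_index_eq)

lemma in_set_cyc_at: "x \<in> set p \<longleftrightarrow> (\<exists>k\<in>{1..length p}. x = cyc_at p k)"
proof
  assume "x \<in> set p"
  then obtain i where "i < length p" "x = p ! i" by (auto simp: in_set_conv_nth)
  then show "\<exists>k\<in>{1..length p}. x = cyc_at p k" by (intro bexI[of _ "i + 1"]) (auto simp: cyc_at_nth)
qed (auto simp: cyc_at_nth)

lemma graph_cycle_edge:
  assumes "graph_cycle G p" "k \<in> {1..length p}"
  shows "{cyc_at p k, cyc_at p (k + 1)} \<in> edges G"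
proof -
  have p: "p \<noteq> []" using assms by (auto simp: graph_cycle_def)
  have "{(p @ [hd p]) ! (k - 1), (p @ [hd p]) ! Suc (k - 1)} \<in> path_edges (p @ [hd p])"
    unfolding path_edges_nth using assms(2) by auto
  moreover have "(p @ [hd p]) ! (k - 1) = cyc_at p k"
    using assms(2) by (auto simp: cyc_at_nth nth_append)
  moreover have "(p @ [hd p]) ! Suc (k - 1) = cyc_at p (k + 1)"
  proof (cases "k = length p")
    case True
    then show ?thesis using p assms(2) cyc_at_Suc_length[OF p] cyc_at_nth[of 1 p] by (simp add: nth_append hd_conv_nth Suc_le_eq)
  next
    case False
    then show ?thesis using assms(2) cyc_at_nth[of "k + 1" p] by (simp add: nth_append)
  qed
  ultimately show ?thesis using assms(1) by (auto simp: graph_cycle_def)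
qed

text \<open>The wrap-around is resolved here once: \<open>r\<close> and \<open>s\<close> are genuine
  positions of the two cycle neighbours, and chords at \<open>k\<close> are its edges to all other
  positions.\<close>

lemma cycle_neighbours:
  assumes "graph_cycle G p" "k \<in> {1..length p}"
  obtains r s where "r \<in> {1..length p}" "s \<in> {1..length p}" "distinct [k, r, s]"
    "cyc_at p (k - 1) = cyc_at p r" "cyc_at p (k + 1) = cyc_at p s" "{cyc_at p k, cyc_at p r} \<in> edges G" "{cyc_at p k, cyc_at p s} \<in> edges G"
    "\<And>j. chord_between G p k j \<longleftrightarrow> j \<in> {1..length p} - {k, r, s} \<and> {cyc_at p k, cyc_at p j} \<in> edges G"
proof -
  have n: "3 \<le> length p" "p \<noteq> []" using assms(1) by (auto simp: graph_cycle_def)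
  define r where "r = (if k = 1 then length p else k - 1)"
  define s where "s = (if k = length p then 1 else k + 1)"
  have rs: "r \<in> {1..length p}" "s \<in> {1..length p}" "distinct [k, r, s]"
    using n assms(2) by (auto simp: r_def s_def)
  have at: "cyc_at p (k - 1) = cyc_at p r" "cyc_at p (k + 1) = cyc_at p s"
    using cyc_at_0[OF n(2)] cyc_at_Suc_length[OF n(2)] by (auto simp: r_def s_def)
  have "{cyc_at p r, cyc_at p (r + 1)} \<in> edges G" by (rule graph_cycle_edge[OF assms(1) rs(1)])
  moreover have "cyc_at p (r + 1) = cyc_at p k"
    using cyc_at_Suc_length[OF n(2)] assms(2) by (auto simp: r_def)
  ultimately have e: "{cyc_at p k, cyc_at p r} \<in> edges G" "{cyc_at p k, cyc_at p s} \<in> edges G"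
    using graph_cycle_edge[OF assms] at by (auto simp: insert_commute)
  have "chord_between G p k j \<longleftrightarrow> j \<in> {1..length p} - {k, r, s} \<and> {cyc_at p k, cyc_at p j} \<in> edges G" for j
    using assms(2) n unfolding chord_between_def by (auto simp: r_def s_def doubleton_eq_iff)
  then show ?thesis using that rs at e by blast
qed

lemma chord_between_sym: "chord_between G p i j \<Longrightarrow> chord_between G p j i"
  by (auto simp: chord_between_def insert_commute)

text \<open>Two chords together with the two cycle edges would give degree at least 4.\<close>

lemma chord_between_unique:
  assumes G: "simple_graph G" "subcubic G" and cyc: "graph_cycle G p"
    and j: "chord_between G p i j" and k: "chord_between G p i k"
  shows "j = k"
proof (rule ccontr)
  assume "j \<noteq> k"
  have i: "i \<in> {1..length p}" using j by (simp add: chord_between_def)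
  obtain r s where rs: "r \<in> {1..length p}" "s \<in> {1..length p}" "distinct [i, r, s]"
    "{cyc_at p i, cyc_at p r} \<in> edges G" "{cyc_at p i, cyc_at p s} \<in> edges G"
    "\<And>j. chord_between G p i j \<longleftrightarrow> j \<in> {1..length p} - {i, r, s} \<and> {cyc_at p i, cyc_at p j} \<in> edges G"
    using cycle_neighbours[OF cyc i] by metis
  have p: "distinct p" "set p \<subseteq> vertices G" using cyc by (auto simp: graph_cycle_def)
  have jk: "j \<in> {1..length p} - {i, r, s}" "k \<in> {1..length p} - {i, r, s}"
    "{cyc_at p i, cyc_at p j} \<in> edges G" "{cyc_at p i, cyc_at p k} \<in> edges G"
    using rs(6) j k by blast+
  let ?N = "{r, s, j, k}"
  have N: "?N \<subseteq> {1..length p}" "card ?N = 4" "i \<notin> ?N"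
    using rs(1-3) jk \<open>j \<noteq> k\<close> by auto
  have "inj_on (\<lambda>l. {cyc_at p i, cyc_at p l}) ?N"
  proof (rule inj_onI)
    fix l l' assume "l \<in> ?N" "l' \<in> ?N" "{cyc_at p i, cyc_at p l} = {cyc_at p i, cyc_at p l'}"
    moreover have "l \<in> {1..length p}" "l' \<in> {1..length p}" using N(1) calculation by blast+
    ultimately show "l = l'" using cyc_at_eq_iff[OF p(1)] by (metis doubleton_eq_iff)
  qed
  then have "4 = card ((\<lambda>l. {cyc_at p i, cyc_at p l}) ` ?N)" using N(2) by (simp only: card_image)
  also have "\<dots> \<le> vertex_degree G (cyc_at p i)"
    unfolding vertex_degree_def
  proof (rule card_mono)
    show "finite {e \<in> edges G. cyc_at p i \<in> e}"
      using G(1) by (auto simp: simple_graph_def intro!: finite_subset[of _ "Pow (vertices G)"])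
    show "(\<lambda>l. {cyc_at p i, cyc_at p l}) ` ?N \<subseteq> {e \<in> edges G. cyc_at p i \<in> e}"
      using rs(4,5) jk by auto
  qed
  also have "\<dots> \<le> 3"
    using G(2) p(2) in_set_cyc_at[of "cyc_at p i" p] i unfolding subcubic_def by blast
  finally show False by simp
qed

lemma mate_eq:
  assumes "simple_graph G" "subcubic G" "graph_cycle G p" "chord_between G p i j"
  shows "mate G p i = j"
  using assms chord_between_unique[OF assms(1-3)] unfolding mate_def by (metis someI)

lemma chord_between_mate: "mate G p i \<noteq> i \<Longrightarrow> chord_between G p i (mate G p i)"
  unfolding mate_def by (metis someI)

lemma no_crossing_positions:
  assumes G: "simple_graph G" and dr: "outer_drawing G pos \<gamma>" and cyc: "graph_cycle G p"
    and ch: "chord_between G p i k" "chord_between G p j l" and less: "i < j" "j < k" "k < l"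
  shows False
proof -
  have r: "i \<in> {1..length p}" "j \<in> {1..length p}" "k \<in> {1..length p}" "l \<in> {1..length p}"
    using ch by (auto simp: chord_between_def)
  define a c b d where abcd: "a = p ! (i - 1)" "c = p ! (j - 1)" "b = p ! (k - 1)" "d = p ! (l - 1)"
  have "i - 1 < j - 1" "j - 1 < k - 1" "k - 1 < l - 1" "l - 1 < length p"
    using less r by auto
  then obtain P Q R S T where p: "p = T @ a # P @ c # Q @ b # R @ d # S"
    unfolding abcd by (rule four_positions)
  \<comment> \<open>The cycle is rotated to start at \<open>a\<close>; the prefix \<open>T\<close>
    joins the last gap \<open>S\<close>.\<close>
  have "graph_cycle G ((a # P @ c # Q @ b # R @ d # S) @ T)"
    using cyc unfolding p by (rule graph_cycle_rotate)
  moreover have "{a, b} \<in> edges G" "{c, d} \<in> edges G"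
    using ch unfolding chord_between_def abcd by (simp_all only: cyc_at_nth[OF r(1)] cyc_at_nth[OF r(2)]
      cyc_at_nth[OF r(3)] cyc_at_nth[OF r(4)])
  ultimately show False
    using no_crossing_chords[OF G dr, of a P c Q b R d "S @ T"] by simp
qed

text \<open>As the cycle is Hamiltonian, every neighbour has a position; it is adjacent along the
  cycle or is the chord partner. The list has the shape used in \<open>labelled\<close>.\<close>

lemma neighbours_at:
  assumes G: "simple_graph G" "subcubic G" and cyc: "graph_cycle G p" "set p = vertices G"
    and k: "k \<in> {1..length p}"
  shows "{x. {cyc_at p k, x} \<in> edges G} =
    set ([cyc_at p (k - 1), cyc_at p (k + 1)] @ (if mate G p k = k then [] else [cyc_at p (mate G p k)]))"
proof -
  obtain r s where rs: "cyc_at p (k - 1) = cyc_at p r" "cyc_at p (k + 1) = cyc_at p s"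
    "{cyc_at p k, cyc_at p r} \<in> edges G" "{cyc_at p k, cyc_at p s} \<in> edges G"
    "\<And>j. chord_between G p k j \<longleftrightarrow> j \<in> {1..length p} - {k, r, s} \<and> {cyc_at p k, cyc_at p j} \<in> edges G"
    using cycle_neighbours[OF cyc(1) k] by metis
  have "x \<in> set ([cyc_at p (k - 1), cyc_at p (k + 1)] @ (if mate G p k = k then [] else [cyc_at p (mate G p k)]))"
    if x: "{cyc_at p k, x} \<in> edges G" for x
  proof -
    have "x \<in> vertices G" "x \<noteq> cyc_at p k"
      using G(1) x unfolding simple_graph_def by (auto dest!: bspec[of _ _ "{cyc_at p k, x}"])
    then obtain j where j: "j \<in> {1..length p}" "x = cyc_at p j" "j \<noteq> k"
      using cyc(2) in_set_cyc_at[of x p] by blast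
    show ?thesis
    proof (cases "j \<in> {r, s}")
      case True
      then show ?thesis using rs(1,2) j(2) by auto
    next
      case False
      then have "chord_between G p k j" using rs(5) j x by simp
      then have "mate G p k = j" by (rule mate_eq[OF G cyc(1)])
      then show ?thesis using j by simp
    qed
  qed
  moreover have "{cyc_at p k, cyc_at p (mate G p k)} \<in> edges G" if "mate G p k \<noteq> k"
    using chord_between_mate[OF that] by (simp add: chord_between_def)
  then have "{cyc_at p k, x} \<in> edges G"
    if "x \<in> set ([cyc_at p (k - 1), cyc_at p (k + 1)] @ (if mate G p k = k then [] else [cyc_at p (mate G p k)]))" for x
    using rs(1-4) that by (auto split: if_splits)
  ultimately show ?thesis by blast
qed

theorem theorem3p1:
  fixes G :: "'a ugraph" and v :: 'a and c :: color
  assumes "simple_graph G"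
    and "k_connected 2 G"
    and "subcubic G"
    and "outerplanar G"
    and "v \<in> vertices G"
  shows "\<exists>f. crumby_coloring G f \<and> f v = c"
proof -
  obtain pos \<gamma> where dr: "outer_drawing G pos \<gamma>"
    using assms(4) by (auto simp: outerplanar_def outer_drawing_def)
  obtain p0 where "graph_cycle G p0" "set p0 = vertices G"
    using exists_Hamiltonian_cycle[OF assms(1,2) dr] by blast
  \<comment> \<open>The cycle is rotated so that \<open>v\<close> occupies position 1, where the
    color can be prescribed.\<close>
  then obtain p where cyc: "graph_cycle G p" and p: "set p = vertices G" "p ! 0 = v"
    using graph_cycle_from[of G p0 v] assms(5) by (metis nth_Cons_0)
  let ?n = "length p" and ?m = "mate G p"
  have n: "3 \<le> ?n" "p \<noteq> []" "distinct p" using cyc by (auto simp: graph_cycle_def)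
  note mate = mate_eq[OF assms(1,3) cyc]
  have inv: "?m (?m k) = k" for k
    using chord_between_mate[of G p k] chord_between_sym[of G p k "?m k"] mate by metis
  have gap: "?m k \<noteq> k + 1" for k
    using chord_between_mate[of G p k] by (auto simp: chord_between_def)
  have closed: "mate_closed ?m 1 (?n + 1)"
    unfolding mate_closed_def
  proof
    fix k assume "k \<in> {1..<?n + 1}"
    then show "?m k \<in> {1..<?n + 1}"
      using chord_between_mate[of G p k] by (cases "?m k = k") (auto simp: chord_between_def)
  qed
  \<comment> \<open>If the mate of \<open>l\<close> lay beyond \<open>?m k\<close> or before
    \<open>k\<close>, the chords at \<open>k\<close> and \<open>l\<close> would cross; in the second
    case the chord at \<open>l\<close> is read from its other end.\<close>
  have nested: "k < ?m l \<and> ?m l < ?m k" if kl: "k < l" "l < ?m k" for k l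
  proof (cases "?m l = l")
    case False
    note l = chord_between_mate[OF False]
    have k: "chord_between G p k (?m k)" using kl by (intro chord_between_mate) simp
    have "?m l \<noteq> k" "?m l \<noteq> ?m k" using inv kl by (metis less_irrefl)+
    moreover have "\<not> ?m k < ?m l"
      using no_crossing_positions[OF assms(1) dr cyc k l kl] by blast
    moreover have "\<not> ?m l < k"
      using no_crossing_positions[OF assms(1) dr cyc chord_between_sym[OF l] k _ kl] by blast
    ultimately show ?thesis by simp
  qed (use kl in simp)
  obtain g where g: "labelled ?m g 1 (?n + 1)" "g 0 = g ?n" "g (?n + 1) = g 1" "g 1 = Bl \<longleftrightarrow> c = Blue"
    using cyclic_labelling[OF closed n(1) inv gap nested] by blast
  \<comment> \<open>Vertices on the cycle are distinct, so \<open>lab\<close> transfers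
    \<open>g\<close> from positions to vertices.\<close>
  define lab where "lab x = g (SOME k. k \<in> {1..?n} \<and> cyc_at p k = x)" for x
  have lab: "lab (cyc_at p k) = g k" if "k \<in> {1..?n}" for k
  proof -
    have "(SOME k'. k' \<in> {1..?n} \<and> cyc_at p k' = cyc_at p k) = k"
      using that cyc_at_eq_iff[OF n(3)] by (intro some_equality) auto
    then show ?thesis by (simp add: lab_def)
  qed
  \<comment> \<open>The closing equations for \<open>g\<close> extend this to the positions 0 and
    \<open>?n + 1\<close>, which occur as neighbours of the ends.\<close>
  have lab': "lab (cyc_at p k) = g k" if "k \<le> ?n + 1" for k
  proof -
    consider "k = 0" | "k = ?n + 1" | "k \<in> {1..?n}" using \<open>k \<le> ?n + 1\<close> by force
    then show ?thesis
      using cyc_at_0[OF n(2)] cyc_at_Suc_length[OF n(2)] lab n(1) g(2,3) by cases simp_all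
  qed
  have "crumby_coloring G (\<lambda>w. if lab w = Bl then Blue else Red)"
  proof (rule crumby_coloring_of_labels[OF assms(1)])
    fix w assume "w \<in> vertices G"
    then obtain k where k: "k \<in> {1..?n}" "w = cyc_at p k" using p(1) in_set_cyc_at[of w p] by auto
    let ?ws = "[cyc_at p (k - 1), cyc_at p (k + 1)] @ (if ?m k = k then [] else [cyc_at p (?m k)])"
    have "?m k \<in> {1..<?n + 1}" using closed k(1) unfolding mate_closed_def by auto
    then have "map lab ?ws = [g (k - 1), g (k + 1)] @ (if ?m k = k then [] else [g (?m k)])"
      using lab'[of "k - 1"] lab'[of "k + 1"] lab'[of "?m k"] k(1) by auto
    moreover have "admissible (g k) \<dots>" using g(1) k(1) unfolding labelled_def by auto
    ultimately have "admissible (lab w) (map lab ?ws)" using lab k by simp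
    then show "\<exists>ws. set ws = {x. {w, x} \<in> edges G} \<and> admissible (lab w) (map lab ws)"
      using neighbours_at[OF assms(1,3) cyc p(1) k(1)] k(2) by blast
  qed
  moreover have "lab v = g 1" using lab[of 1] n(1) p(2) by (simp add: cyc_at_nth)
  ultimately show ?thesis
    using g(4) by (intro exI[of _ "\<lambda>w. if lab w = Bl then Blue else Red"]) (cases c; simp)
qed

end
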